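(* Let $H$ be a Hilbert space and let $A$ be a self-adjoint (possibly unbounded) operator in $H$. Then there exists one and only one spectral family $(E(\lambda))_{\lambda\in\mathbb{R}}$ in $H$ such that $$A=\int_{\mathbb{R}}\lambda\,dE(\lambda).$$
   Context: Hilbert spaces may be real or complex; scalar products are linear in the first argument. "Projection" means orthogonal projection. A spectral family in $H$ is a family $(E(\lambda))_{\lambda\in\mathbb{R}}$ of orthogonal projections in $H$ such that $E(\lambda)\le E(\mu)$ for $\lambda\le\mu$; $\lambda\mapsto E(\lambda)x$ is right-continuous for every $x\in H$; and for every $x\in H$, $E(\lambda)x\to 0$ as $\lambda\to-\infty$ and $E(\lambda)x\to x$ as $\lambda\to\infty$. For a self-adjoint operator $A$ with domain $D(A)$, the notation $A=\int_{\mathbb{R}}\lambda\,dE(\lambda)$ means: $D(A)=\{x\in H : \int_{\mathbb{R}}\lambda^2\,d\langle E(\lambda)x,x\rangle<\infty\}$, and for all $x\in D(A)$ one has $\langle Ax,x\rangle=\int_{\mathbb{R}}\lambda\,d\langle E(\lambda)x,x\rangle$ and $\|Ax\|^2=\int_{\mathbb{R}}\lambda^2\,d\langle E(\lambda)x,x\rangle$ (Lebesgue-Stieltjes integrals). *)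

theory Defs
  imports "HOL-Analysis.Analysis"
begin

text \<open>
  The axioms below single out the two scalar fields: up to isomorphism, the only instances are
  the reals with trivial conjugation and the complex numbers with the usual one
  (see \<open>real_or_complex_cases\<close>).
\<close>

class real_or_complex = real_normed_field +
  fixes kcnj :: "'a \<Rightarrow> 'a"
    and kRe :: "'a \<Rightarrow> real"
  assumes kcnj_add: "kcnj (a + b) = kcnj a + kcnj b"
    and kcnj_mult: "kcnj (a * b) = kcnj a * kcnj b"
    and mult_kcnj_scaleR: "a * kcnj a = (norm a)\<^sup>2 *\<^sub>R 1"
    and add_kcnj_scaleR: "a + kcnj a = (2 * kRe a) *\<^sub>R 1"

instantiation real :: real_or_complex
begin
definition kcnj_real :: "real \<Rightarrow> real" where "kcnj_real a = a"
definition kRe_real :: "real \<Rightarrow> real" where "kRe_real a = a"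
instance
  by standard (simp_all add: kcnj_real_def kRe_real_def power2_eq_square)
end

instantiation complex :: real_or_complex
begin
definition kcnj_complex :: "complex \<Rightarrow> complex" where "kcnj_complex a = cnj a"
definition kRe_complex :: "complex \<Rightarrow> real" where "kRe_complex a = Re a"
instance
  by standard
    (simp_all add: kcnj_complex_def kRe_complex_def scaleR_conv_of_real complex_norm_square complex_add_cnj
      del: of_real_mult of_real_power)
end

lemma mult_kcnj: "a * kcnj a = of_real ((norm a)\<^sup>2)" for a :: "'k::real_or_complex"
  by (simp add: mult_kcnj_scaleR of_real_def)

lemma add_kcnj: "a + kcnj a = of_real (2 * kRe a)" for a :: "'k::real_or_complex"
  by (simp add: add_kcnj_scaleR of_real_def)

lemma kcnj_of_real: "kcnj (of_real r :: 'k::real_or_complex) = of_real r"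
proof (cases "r = 0")
  case True
  have "kcnj (0::'k) = 0" using kcnj_add[of "0::'k" 0] by simp
  with True show ?thesis by simp
next
  case False
  have "of_real r * kcnj (of_real r :: 'k) = of_real r * of_real r"
    using mult_kcnj[of "of_real r :: 'k"] by (simp add: power2_eq_square flip: of_real_mult)
  with False show ?thesis by simp
qed

lemma real_or_complex_cases:
  "(\<forall>a::'k::real_or_complex. a = of_real (kRe a) \<and> kcnj a = a) \<or>
   (\<exists>i::'k. i * i = -1 \<and> kcnj i = - i \<and> (\<forall>a. \<exists>s. a = of_real (kRe a) + of_real s * i))"
proof (cases "\<forall>a::'k. a = of_real (kRe a)")
  case True
  then show ?thesis by (metis kcnj_of_real)
next
  case False
  have sq: "(a - of_real (kRe a)) * (a - of_real (kRe a)) = - of_real ((norm (a - of_real (kRe a)))\<^sup>2)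
     \<and> kcnj (a - of_real (kRe a)) = - (a - of_real (kRe a))" for a :: 'k
  proof -
    let ?b = "a - of_real (kRe a)"
    have "kcnj ?b + of_real (kRe a) = kcnj a"
      using kcnj_add[of ?b "of_real (kRe a)"] by (simp add: kcnj_of_real)
    moreover have "kcnj a = of_real (2 * kRe a) - a"
      using add_kcnj[of a] by (simp add: algebra_simps)
    ultimately have c: "kcnj ?b = - ?b" by (simp add: algebra_simps)
    have "?b * ?b = - (?b * kcnj ?b)" unfolding c by (simp add: algebra_simps)
    then show ?thesis using c mult_kcnj[of ?b] by simp
  qed
  from False obtain c :: 'k where c: "c \<noteq> of_real (kRe c)" by blast
  define d where "d = c - of_real (kRe c)"
  define i where "i = of_real (inverse (norm d)) * d"
  have d0: "norm d \<noteq> 0" using c by (simp add: d_def)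
  have dd: "d * d = - of_real ((norm d)\<^sup>2)" "kcnj d = - d"
    using sq[of c] by (simp_all add: d_def)
  have "i * i = of_real (inverse (norm d) * inverse (norm d)) * (d * d)"
    by (simp add: i_def algebra_simps)
  also have "\<dots> = - of_real (inverse (norm d) * inverse (norm d) * (norm d)\<^sup>2)"
    unfolding dd by (simp only: of_real_mult mult_minus_right)
  also have "inverse (norm d) * inverse (norm d) * (norm d)\<^sup>2 = 1"
    using d0 by (simp add: power2_eq_square field_simps)
  finally have ii: "i * i = -1" by simp
  have ci: "kcnj i = - i"
    by (simp add: i_def kcnj_mult dd kcnj_of_real flip: of_real_inverse)
  have "\<exists>s. a = of_real (kRe a) + of_real s * i" for a :: 'k
  proof -
    define b where "b = a - of_real (kRe a)"
    let ?n = "of_real (norm b) :: 'k"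
    have "b * b = - (?n * ?n)"
      using sq[of a] by (simp add: b_def power2_eq_square)
    then have "(b - ?n * i) * (b + ?n * i) = - (?n * ?n) - (?n * ?n) * (i * i)"
      by (simp add: algebra_simps)
    then have "(b - ?n * i) * (b + ?n * i) = 0" unfolding ii by simp
    then have "b = of_real (norm b) * i \<or> b = of_real (- norm b) * i"
      by (auto simp: add_eq_0_iff2)
    then obtain s where "b = of_real s * i" by blast
    then show ?thesis unfolding b_def by (metis add.commute diff_add_cancel)
  qed
  with ii ci show ?thesis by blast
qed


text \<open>
  Hilbert spaces over the scalar field \<^typ>\<open>'k\<close>.  The class \<^class>\<open>banach\<close> supplies
  completeness, norm and topology; the axioms tie them to the scalar product.
\<close>

locale hilbert_space = vector_space smul
  for smul :: "'k::real_or_complex \<Rightarrow> 'h::banach \<Rightarrow> 'h" +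
  fixes ip :: "'h \<Rightarrow> 'h \<Rightarrow> 'k"
  assumes scale_of_real: "smul (of_real r) x = r *\<^sub>R x"
    and ip_add_left: "ip (x + y) z = ip x z + ip y z"
    and ip_scale_left: "ip (smul a x) z = a * ip x z"
    and ip_commute: "ip y x = kcnj (ip x y)"
    and ip_self: "ip x x = of_real ((norm x)\<^sup>2)"

lemma hilbert_space_real:
  "hilbert_space scaleR (inner :: 'h::{real_inner, banach} \<Rightarrow> 'h \<Rightarrow> real)"
  by unfold_locales
    (simp_all add: kcnj_real_def algebra_simps inner_commute power2_norm_eq_inner)

lemma hilbert_space_complex: "hilbert_space (*) (\<lambda>x y::complex. x * cnj y)"
  by unfold_locales
    (simp_all add: kcnj_complex_def algebra_simps scaleR_conv_of_real complex_norm_square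
      del: of_real_power)


text \<open>
  An unbounded operator is a pair of a domain \<open>D\<close> and a map \<open>A\<close> whose values outside \<open>D\<close>
  are irrelevant.
\<close>

definition linear_operator ::
  "('k::real_or_complex \<Rightarrow> 'h::banach \<Rightarrow> 'h) \<Rightarrow> 'h set \<Rightarrow> ('h \<Rightarrow> 'h) \<Rightarrow> bool" where
  "linear_operator smul D A \<longleftrightarrow>
     module.subspace smul D \<and>
     (\<forall>x\<in>D. \<forall>y\<in>D. A (x + y) = A x + A y) \<and>
     (\<forall>a. \<forall>x\<in>D. A (smul a x) = smul a (A x))"

definition adjoint_domain :: "('h::banach \<Rightarrow> 'h \<Rightarrow> 'k) \<Rightarrow> 'h set \<Rightarrow> ('h \<Rightarrow> 'h) \<Rightarrow> 'h set" where
  "adjoint_domain ip D A = {y. \<exists>z. \<forall>x\<in>D. ip (A x) y = ip x z}"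

text \<open>For dense \<open>D\<close> and \<open>y\<close> in the adjoint domain, the vector \<open>z\<close> is unique.\<close>

definition adjoint_op ::
  "('h::banach \<Rightarrow> 'h \<Rightarrow> 'k) \<Rightarrow> 'h set \<Rightarrow> ('h \<Rightarrow> 'h) \<Rightarrow> 'h \<Rightarrow> 'h" where
  "adjoint_op ip D A y = (THE z. \<forall>x\<in>D. ip (A x) y = ip x z)"

definition self_adjoint ::
  "('k::real_or_complex \<Rightarrow> 'h::banach \<Rightarrow> 'h) \<Rightarrow> ('h \<Rightarrow> 'h \<Rightarrow> 'k) \<Rightarrow> 'h set \<Rightarrow> ('h \<Rightarrow> 'h) \<Rightarrow> bool" where
  "self_adjoint smul ip D A \<longleftrightarrow>
     linear_operator smul D A \<and> closure D = UNIV \<and>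
     adjoint_domain ip D A = D \<and> (\<forall>y\<in>D. adjoint_op ip D A y = A y)"

definition orthogonal_projection ::
  "('k::real_or_complex \<Rightarrow> 'h::banach \<Rightarrow> 'h) \<Rightarrow> ('h \<Rightarrow> 'h \<Rightarrow> 'k) \<Rightarrow> ('h \<Rightarrow> 'h) \<Rightarrow> bool" where
  "orthogonal_projection smul ip P \<longleftrightarrow>
     (\<exists>M. module.subspace smul M \<and> closed M \<and>
        (\<forall>x. P x \<in> M \<and> (\<forall>y\<in>M. ip (x - P x) y = 0)))"

text \<open>
  The order of symmetric operators.  Their quadratic forms are real-valued, so taking the
  real part loses nothing.
\<close>

definition op_le ::
  "('h::banach \<Rightarrow> 'h \<Rightarrow> 'k::real_or_complex) \<Rightarrow> ('h \<Rightarrow> 'h) \<Rightarrow> ('h \<Rightarrow> 'h) \<Rightarrow> bool" where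
  "op_le ip P Q \<longleftrightarrow> (\<forall>x. kRe (ip (P x) x) \<le> kRe (ip (Q x) x))"

definition spectral_family ::
  "('k::real_or_complex \<Rightarrow> 'h::banach \<Rightarrow> 'h) \<Rightarrow> ('h \<Rightarrow> 'h \<Rightarrow> 'k) \<Rightarrow> (real \<Rightarrow> 'h \<Rightarrow> 'h) \<Rightarrow> bool" where
  "spectral_family smul ip E \<longleftrightarrow>
     (\<forall>l. orthogonal_projection smul ip (E l)) \<and>
     (\<forall>l m. l \<le> m \<longrightarrow> op_le ip (E l) (E m)) \<and>
     (\<forall>x l. continuous (at_right l) (\<lambda>m. E m x)) \<and>
     (\<forall>x. ((\<lambda>l. E l x) \<longlongrightarrow> 0) at_bot) \<and>
     (\<forall>x. ((\<lambda>l. E l x) \<longlongrightarrow> x) at_top)"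

text \<open>
  The Lebesgue-Stieltjes measure \<open>d\<langle>E(\<lambda>)x,x\<rangle>\<close>.  For a spectral family \<open>E\<close> the function
  \<open>\<lambda> \<mapsto> \<langle>E(\<lambda>)x,x\<rangle>\<close> is real-valued, nondecreasing and right-continuous, as
  \<^const>\<open>interval_measure\<close> requires.
\<close>

definition spectral_measure ::
  "('h::banach \<Rightarrow> 'h \<Rightarrow> 'k::real_or_complex) \<Rightarrow> (real \<Rightarrow> 'h \<Rightarrow> 'h) \<Rightarrow> 'h \<Rightarrow> real measure" where
  "spectral_measure ip E x = interval_measure (\<lambda>l. kRe (ip (E l x) x))"

text \<open>
  The meaning of \<open>A = \<integral> \<lambda> dE(\<lambda>)\<close>.  The integrability clause only makes explicit that the
  integral exists: it follows from square integrability, the measure being finite.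
\<close>

definition is_spectral_integral ::
  "('h::banach \<Rightarrow> 'h \<Rightarrow> 'k::real_or_complex) \<Rightarrow> 'h set \<Rightarrow> ('h \<Rightarrow> 'h) \<Rightarrow> (real \<Rightarrow> 'h \<Rightarrow> 'h) \<Rightarrow> bool" where
  "is_spectral_integral ip D A E \<longleftrightarrow>
     D = {x. (\<integral>\<^sup>+ l. ennreal (l\<^sup>2) \<partial>spectral_measure ip E x) < \<infinity>} \<and>
     (\<forall>x\<in>D.
        integrable (spectral_measure ip E x) (\<lambda>l. l) \<and>
        ip (A x) x = of_real (\<integral>l. l \<partial>spectral_measure ip E x) \<and>
        (norm (A x))\<^sup>2 = (\<integral>l. l\<^sup>2 \<partial>spectral_measure ip E x))"

end

theory Submission
  imports Defs "HOL-Probability.Distribution_Functions"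
begin

text \<open>
  Real parts of scalar products turn \<open>H\<close> into a real Hilbert space in which \<open>A\<close> stays self-adjoint, so
  the work is done over the reals.  For each \<open>l\<close> there is exactly one projection \<open>E l\<close> that reduces \<open>A\<close>
  with \<open>A \<le> l\<close> on its range and \<open>A > l\<close> on its kernel.  It exists because the sign of \<open>T = A - l\<close>
  is the sign of the bounded operator \<open>B = T (1 + T\<^sup>2)\<^sup>-\<^sup>1\<close>, which is read off the kernel of
  \<open>\<bar>B\<bar> + B\<close>; it is unique because it commutes with every projection that reduces \<open>A\<close>.  Monotonicity,
  continuity and the limits of \<open>E\<close> all follow from this characterization.  On the range of
  \<open>E b - E a\<close> the operator lies between \<open>a\<close> and \<open>b\<close>, which yields the integral formulas; conversely
  these formulas force any spectral family to have the characterizing property.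
\<close>

section \<open>Real Hilbert spaces\<close>

text \<open>Over the reals there are no resolvents at \<open>i\<close> and \<open>-i\<close>. Still
  \<open>1 + T\<^sup>2\<close> can be inverted, because the orthogonal complement of the closed
  graph of \<open>T\<close> is a rotated copy of that graph. The only nontrivial function of a
  bounded operator that is formed is a square root; its iteration keeps commutation relations in the
  limit, and this carries through to the projection. The asymmetry between \<open>\<le>\<close> and
  \<open><\<close> decides that eigenvectors for \<open>l\<close> belong to the range of
  \<open>E l\<close>. Without it the projection would not be determined, and with it continuity
  comes from the right. Commutation with reducing projections is built into the choice of
  \<open>E l\<close>: two such projections are compared through the product of one with the
  complement of the other, and that product is a projection only if the factors commute. No
  operator-valued integral is formed. Only the quadratic forms of \<open>A\<close> and of its square
  are compared with integrals, first on bounded intervals, where \<open>A\<close> is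
  bounded.\<close>

locale real_hilbert =
  fixes ip :: "'h::banach \<Rightarrow> 'h \<Rightarrow> real" (\<open>\<langle>_, _\<rangle>\<close>)
  assumes add_left': "\<langle>x + y, z\<rangle> = \<langle>x, z\<rangle> + \<langle>y, z\<rangle>"
    and scaleR_left': "\<langle>r *\<^sub>R x, z\<rangle> = r * \<langle>x, z\<rangle>"
    and commute: "\<langle>x, y\<rangle> = \<langle>y, x\<rangle>"
    and self: "\<langle>x, x\<rangle> = (norm x)\<^sup>2"
begin

lemma add_right': "\<langle>x, y + z\<rangle> = \<langle>x, y\<rangle> + \<langle>x, z\<rangle>"
  by (metis add_left' commute)

lemma scaleR_right': "\<langle>x, r *\<^sub>R z\<rangle> = r * \<langle>x, z\<rangle>"
  by (metis scaleR_left' commute)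

lemma cauchy_schwarz: "\<bar>\<langle>x, y\<rangle>\<bar> \<le> norm x * norm y"
proof -
  have le: "\<langle>u, v\<rangle> \<le> norm u * norm v" for u v
  proof (cases "v = 0 \<or> u = 0")
    case True
    then show ?thesis using scaleR_left'[of 0 u v] scaleR_right'[of u 0 v] by auto
  next
    case False
    \<comment> \<open>Cross-multiplying by the norms avoids division: the squared norm of
      \<open>w\<close> is \<open>2 * (norm u * norm v)\<close> times the difference that has to be
      nonnegative.\<close>
    define w where "w = norm v *\<^sub>R u + (- norm u) *\<^sub>R v"
    have "0 \<le> \<langle>w, w\<rangle>" by (simp add: self)
    also have "\<langle>w, w\<rangle> = norm v * norm v * \<langle>u, u\<rangle> + norm u * norm u * \<langle>v, v\<rangle>
        - 2 * norm u * norm v * \<langle>u, v\<rangle>"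
      using commute[of v u]
      by (simp add: w_def add_left' add_right' scaleR_left' scaleR_right' algebra_simps
          del: scaleR_minus_left)
    also have "\<dots> = 2 * (norm u * norm v) * (norm u * norm v - \<langle>u, v\<rangle>)"
      by (simp add: self power2_eq_square algebra_simps)
    finally have "0 \<le> 2 * (norm u * norm v) * (norm u * norm v - \<langle>u, v\<rangle>)" .
    moreover have "0 < 2 * (norm u * norm v)" using False by simp
    ultimately have "0 \<le> norm u * norm v - \<langle>u, v\<rangle>"
      using mult_pos_neg[of "2 * (norm u * norm v)" "norm u * norm v - \<langle>u, v\<rangle>"] by linarith
    then show ?thesis by linarith
  qed
  have "- \<langle>x, y\<rangle> = \<langle>(-1) *\<^sub>R x, y\<rangle>" by (simp only: scaleR_left')
  then show ?thesis using le[of x y] le[of "(-1) *\<^sub>R x" y] by simp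
qed

sublocale bounded_bilinear ip
proof
  show "\<exists>K. \<forall>a b. norm \<langle>a, b\<rangle> \<le> norm a * norm b * K"
    using cauchy_schwarz by (intro exI[of _ 1]) simp
qed (simp_all add: add_left' add_right' scaleR_left' scaleR_right')

lemmas bilin = add_left add_right diff_left diff_right scaleR_left scaleR_right minus_left minus_right

lemma norm_add_sq: "(norm (x + y))\<^sup>2 = (norm x)\<^sup>2 + 2 * \<langle>x, y\<rangle> + (norm y)\<^sup>2"
  using commute[of y x] by (simp add: self[symmetric] bilin)

lemma norm_diff_sq: "(norm (x - y))\<^sup>2 = (norm x)\<^sup>2 - 2 * \<langle>x, y\<rangle> + (norm y)\<^sup>2"
  using commute[of y x] by (simp add: self[symmetric] bilin)

lemma eqI: "(\<And>z. \<langle>x, z\<rangle> = \<langle>y, z\<rangle>) \<Longrightarrow> x = y"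
proof -
  assume "\<And>z. \<langle>x, z\<rangle> = \<langle>y, z\<rangle>"
  then have "\<langle>x - y, x - y\<rangle> = 0" by (simp add: diff_left)
  then show ?thesis by (simp add: self)
qed

lemma orth_closure:
  assumes "x \<in> closure S" and "\<And>y. y \<in> S \<Longrightarrow> \<langle>z, y\<rangle> = 0"
  shows "\<langle>z, x\<rangle> = 0"
proof -
  have "closed {y. \<langle>z, y\<rangle> = 0}"
    by (intro closed_Collect_eq continuous_intros continuous_on)
  then have "closure S \<subseteq> {y. \<langle>z, y\<rangle> = 0}"
    using assms(2) by (intro closure_minimal) auto
  then show ?thesis using assms(1) by auto
qed

text \<open>A minimizing sequence for the distance to \<open>M\<close> is Cauchy by the parallelogram law.\<close>

lemma projection_exists:
  assumes M: "subspace M" "closed M"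
  shows "\<exists>y\<in>M. \<forall>z\<in>M. \<langle>x - y, z\<rangle> = 0"
proof -
  define d where "d = infdist x M"
  have ne: "M \<noteq> {}" using subspace_0[OF M(1)] by auto
  have d_le: "d \<le> norm (x - y)" if "y \<in> M" for y
    using infdist_le[OF that, of x] by (simp add: d_def dist_norm)
  have d0: "0 \<le> d" by (simp add: d_def infdist_nonneg)
  have "\<exists>y\<in>M. norm (x - y) < d + inverse (real (Suc n))" for n
    using cInf_lessD[of "dist x ` M" "d + inverse (real (Suc n))"] ne
    by (auto simp: d_def infdist_notempty dist_norm)
  then obtain Y where Y: "\<And>n. Y n \<in> M" "\<And>n. norm (x - Y n) < d + inverse (real (Suc n))"
    by metis
  have par: "(norm (Y m - Y n))\<^sup>2 \<le> 2 * ((norm (x - Y m))\<^sup>2 - d\<^sup>2) + 2 * ((norm (x - Y n))\<^sup>2 - d\<^sup>2)" for m n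
  proof -
    define h where "h = (1/2) *\<^sub>R (Y m + Y n)"
    have "h \<in> M" using Y(1) M(1) by (simp add: h_def subspace_add subspace_scale)
    then have "d\<^sup>2 \<le> (norm (x - h))\<^sup>2" using d_le d0 by (simp add: power_mono)
    moreover have "(norm ((x - Y m) + (x - Y n)))\<^sup>2 = 4 * (norm (x - h))\<^sup>2"
    proof -
      have "(x - Y m) + (x - Y n) = 2 *\<^sub>R (x - h)" by (simp add: h_def algebra_simps scaleR_2)
      then show ?thesis by (simp add: power2_eq_square)
    qed
    moreover have "(norm ((x - Y n) - (x - Y m)))\<^sup>2 + (norm ((x - Y m) + (x - Y n)))\<^sup>2
       = 2 * (norm (x - Y m))\<^sup>2 + 2 * (norm (x - Y n))\<^sup>2"
      unfolding norm_add_sq[of "x - Y m" "x - Y n"] norm_diff_sq[of "x - Y n" "x - Y m"]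
      using commute[of "x - Y n" "x - Y m"] by simp
    ultimately show ?thesis by simp
  qed
  have lim: "(\<lambda>n. norm (x - Y n)) \<longlonglongrightarrow> d"
  proof (rule tendsto_sandwich[of "\<lambda>_. d" _ _ "\<lambda>n. d + inverse (real (Suc n))"])
    show "(\<lambda>n. d + inverse (real (Suc n))) \<longlonglongrightarrow> d"
      using tendsto_add[OF tendsto_const LIMSEQ_inverse_real_of_nat, of d] by simp
  qed (use d_le Y in \<open>auto intro!: always_eventually less_imp_le\<close>)
  have "Cauchy Y"
  proof (rule metric_CauchyI)
    fix e :: real assume e: "0 < e"
    have "(\<lambda>n. (norm (x - Y n))\<^sup>2 - d\<^sup>2) \<longlonglongrightarrow> d\<^sup>2 - d\<^sup>2" by (intro tendsto_intros lim)
    then have "\<forall>\<^sub>F n in sequentially. (norm (x - Y n))\<^sup>2 - d\<^sup>2 < e\<^sup>2 / 4"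
      using e by (intro order_tendstoD) auto
    then obtain N where N: "\<And>n. n \<ge> N \<Longrightarrow> (norm (x - Y n))\<^sup>2 - d\<^sup>2 < e\<^sup>2 / 4"
      by (auto simp: eventually_sequentially)
    have "dist (Y m) (Y n) < e" if "m \<ge> N" "n \<ge> N" for m n
    proof -
      have "(norm (Y m - Y n))\<^sup>2 < e\<^sup>2" using par[of m n] N[OF that(1)] N[OF that(2)] by simp
      then have "norm (Y m - Y n) < e" by (rule power2_less_imp_less) (use e in simp)
      then show ?thesis by (simp add: dist_norm)
    qed
    then show "\<exists>N. \<forall>m\<ge>N. \<forall>n\<ge>N. dist (Y m) (Y n) < e" by blast
  qed
  then obtain y where y: "Y \<longlonglongrightarrow> y" by (auto simp: Cauchy_convergent_iff convergent_def)
  have yM: "y \<in> M" using M(2) Y(1) y by (auto intro: closed_sequentially)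
  have "(\<lambda>n. norm (x - Y n)) \<longlonglongrightarrow> norm (x - y)" by (intro tendsto_intros y)
  then have dy: "norm (x - y) = d" using lim LIMSEQ_unique by blast
  have "\<langle>x - y, z\<rangle> = 0" if z: "z \<in> M" for z
  proof (cases "z = 0")
    case False
    \<comment> \<open>This step minimizes the distance from \<open>x\<close> along the line through
      \<open>y\<close> in direction \<open>z\<close>; a nonzero scalar product would push it below
      \<open>d\<close>.\<close>
    define t where "t = \<langle>x - y, z\<rangle> / (norm z)\<^sup>2"
    have "y + t *\<^sub>R z \<in> M" using M(1) yM z by (simp add: subspace_add subspace_scale)
    then have "(norm (x - y))\<^sup>2 \<le> (norm ((x - y) - t *\<^sub>R z))\<^sup>2"
      using d_le[of "y + t *\<^sub>R z"] by (simp add: dy diff_diff_eq d0 power_mono)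
    also have "\<dots> = (norm (x - y))\<^sup>2 - 2 * (t * \<langle>x - y, z\<rangle>) + t * (t * (norm z)\<^sup>2)"
      unfolding norm_diff_sq[of "x - y" "t *\<^sub>R z"] scaleR_right
      by (simp add: power_mult_distrib power2_eq_square)
    also have "t * (norm z)\<^sup>2 = \<langle>x - y, z\<rangle>" using False by (simp add: t_def)
    finally have "t * \<langle>x - y, z\<rangle> \<le> 0" by simp
    then have "\<langle>x - y, z\<rangle> * \<langle>x - y, z\<rangle> \<le> 0"
      using False by (simp add: t_def divide_le_0_iff)
    then show ?thesis using not_square_less_zero[of "\<langle>x - y, z\<rangle>"] by (simp add: mult_le_0_iff) linarith
  qed (simp add: zero_right)
  then show ?thesis using yM by blast
qed

section \<open>Symmetric maps and orthogonal projections\<close>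

definition sym :: "('h \<Rightarrow> 'h) \<Rightarrow> bool" where
  "sym S \<longleftrightarrow> (\<forall>x y. \<langle>S x, y\<rangle> = \<langle>x, S y\<rangle>)"

text \<open>Two equations stand for a closed subspace: symmetry forces linearity, and together with
  idempotence contractivity, so the range is closed.\<close>

definition projection :: "('h \<Rightarrow> 'h) \<Rightarrow> bool" where
  "projection P \<longleftrightarrow> sym P \<and> (\<forall>x. P (P x) = P x)"

lemma projectionI_range:
  assumes "subspace M" and "\<And>x. P x \<in> M" and "\<And>x y. y \<in> M \<Longrightarrow> \<langle>x - P x, y\<rangle> = 0"
  shows "projection P"
proof -
  have "sym P"
    unfolding sym_def
  proof safe
    fix x y
    show "\<langle>P x, y\<rangle> = \<langle>x, P y\<rangle>"
      using assms(3)[OF assms(2)[of y], of x] assms(3)[OF assms(2)[of x], of y]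
        commute[of "P x" "y"] commute[of "P x" "P y"] unfolding diff_left by linarith
  qed
  moreover have "P x = x" if "x \<in> M" for x
  proof -
    have "x - P x \<in> M" using that assms(1,2) by (simp add: subspace_diff)
    then have "\<langle>x - P x, x - P x\<rangle> = 0" by (rule assms(3))
    then show ?thesis by (simp add: self)
  qed
  ultimately show ?thesis using assms(2) by (simp add: projection_def)
qed

lemma projection_onto:
  assumes "subspace M" "closed M"
  obtains P where "projection P" "range P = M"
proof -
  obtain P where P: "\<forall>x. P x \<in> M \<and> (\<forall>y\<in>M. \<langle>x - P x, y\<rangle> = 0)"
    using bchoice[of UNIV "\<lambda>x y. y \<in> M \<and> (\<forall>z\<in>M. \<langle>x - y, z\<rangle> = 0)"] projection_exists[OF assms]
    by blast
  have "x \<in> range P" if "x \<in> M" for x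
  proof -
    have "x - P x \<in> M" using that assms(1) P by (simp add: subspace_diff)
    then have "\<langle>x - P x, x - P x\<rangle> = 0" using P by blast
    then have "P x = x" by (simp add: self)
    then show ?thesis by (metis rangeI)
  qed
  then have "range P = M" using P by blast
  moreover have "projection P" using projectionI_range[OF assms(1)] P by blast
  ultimately show ?thesis by (intro that)
qed

text \<open>For each test vector \<open>z\<close> the number \<open>\<langle>x, S z\<rangle>\<close>
  is linear in \<open>x\<close>, and test vectors separate points.\<close>

lemma sym_linear:
  assumes "sym S"
  shows "linear S"
proof (rule linearI)
  show "S (x + y) = S x + S y" for x y
    by (rule eqI) (simp add: assms[unfolded sym_def, rule_format] bilin)
  show "S (c *\<^sub>R x) = c *\<^sub>R S x" for c x
    by (rule eqI) (simp add: assms[unfolded sym_def, rule_format] bilin)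
qed

lemma sym_bounded_linear:
  assumes "sym S" "\<And>x. norm (S x) \<le> norm x"
  shows "bounded_linear S"
proof (rule bounded_linear_intro[of S 1])
  show "norm (S x) \<le> norm x * 1" for x using assms(2) by simp
qed (simp_all only: linear_add[OF sym_linear[OF assms(1)]] linear_scale[OF sym_linear[OF assms(1)]])

context
  fixes P assumes P: "projection P"
begin

lemma proj_sym: "\<langle>P x, y\<rangle> = \<langle>x, P y\<rangle>"
  using P[unfolded projection_def sym_def] by blast

lemma proj_idem: "P (P x) = P x"
  using P unfolding projection_def by blast

lemma proj_linear: "linear P"
  using P sym_linear[of P] unfolding projection_def by blast

lemma proj_self: "\<langle>P x, x\<rangle> = (norm (P x))\<^sup>2"
  using proj_sym[of "P x" x] by (simp add: proj_idem self)

lemma proj_norm_compl: "(norm (x - P x))\<^sup>2 = (norm x)\<^sup>2 - (norm (P x))\<^sup>2"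
  unfolding norm_diff_sq commute[of x "P x"] proj_self by simp

lemma proj_norm_le: "norm (P x) \<le> norm x"
proof -
  have "0 \<le> (norm x)\<^sup>2 - (norm (P x))\<^sup>2" unfolding proj_norm_compl[symmetric] by simp
  then have "(norm (P x))\<^sup>2 \<le> (norm x)\<^sup>2" by simp
  then show ?thesis by (rule power2_le_imp_le) simp
qed

lemma proj_bounded_linear: "bounded_linear P"
proof (rule bounded_linear_intro[of P 1])
  show "norm (P x) \<le> norm x * 1" for x using proj_norm_le[of x] by simp
qed (simp_all only: linear_add[OF proj_linear] linear_scale[OF proj_linear])

lemma proj_range_iff: "x \<in> range P \<longleftrightarrow> P x = x"
  by (metis proj_idem rangeE rangeI)

lemma proj_orth: "P y = y \<Longrightarrow> \<langle>x - P x, y\<rangle> = 0"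
  by (metis diff_left diff_self proj_sym)

lemmas proj_add = linear_add[OF proj_linear]
  and proj_diff = linear_diff[OF proj_linear]
  and proj_scale = linear_scale[OF proj_linear]
  and proj_0 = linear_0[OF proj_linear]
  and proj_tendsto = bounded_linear.tendsto[OF proj_bounded_linear]

end

lemma projection_compl:
  assumes P: "projection P"
  shows "projection (\<lambda>x. x - P x)"
  unfolding projection_def sym_def
  by (simp add: bilin proj_diff[OF P] proj_idem[OF P] proj_sym[OF P])

lemma projection_comp:
  assumes P: "projection P" and Q: "projection Q" and PQ: "\<And>x. P (Q x) = Q (P x)"
  shows "projection (\<lambda>x. P (Q x))"
proof -
  have "\<langle>P (Q x), y\<rangle> = \<langle>x, P (Q y)\<rangle>" for x y
    by (simp only: PQ[of y] proj_sym[OF P] proj_sym[OF Q])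
  moreover have "P (Q (P (Q x))) = P (Q x)" for x
    by (simp only: PQ proj_idem[OF P] proj_idem[OF Q])
  ultimately show ?thesis by (simp add: projection_def sym_def)
qed

text \<open>A vector \<open>x\<close> in the range of \<open>P\<close> has \<open>(norm x)\<^sup>2 =
  \<langle>P x, x\<rangle> \<le> \<langle>Q x, x\<rangle> = (norm (Q x))\<^sup>2\<close>, so its
  part orthogonal to the range of \<open>Q\<close> vanishes. The second equation is the adjoint of
  the first.\<close>

lemma projection_le:
  assumes P: "projection P" and Q: "projection Q" and le: "\<And>x. \<langle>P x, x\<rangle> \<le> \<langle>Q x, x\<rangle>"
  shows "Q (P x) = P x" "P (Q x) = P x"
proof -
  show *: "Q (P x) = P x" for x
  proof -
    have "(norm (P x - Q (P x)))\<^sup>2 \<le> 0"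
      using le[of "P x"] by (simp add: proj_norm_compl[OF Q] proj_self[OF Q] proj_idem[OF P] self)
    then show ?thesis by simp
  qed
  show "P (Q x) = P x"
    by (rule eqI) (simp add: proj_sym[OF P] proj_sym[OF Q] *)
qed

text \<open>Makes the projection theorem available for closed graphs in the product space.\<close>

lemma product_hilbert: "real_hilbert (\<lambda>p q. \<langle>fst p, fst q\<rangle> + \<langle>snd p, snd q\<rangle>)"
proof
  show "\<langle>fst p, fst q\<rangle> + \<langle>snd p, snd q\<rangle> = \<langle>fst q, fst p\<rangle> + \<langle>snd q, snd p\<rangle>" for p q
    using commute[of "fst p" "fst q"] commute[of "snd p" "snd q"] by simp
  show "\<langle>fst p, fst p\<rangle> + \<langle>snd p, snd p\<rangle> = (norm p)\<^sup>2" for p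
    by (simp add: self norm_prod_def)
qed (simp_all add: add_left' scaleR_left' distrib_left)

end

text \<open>
  For \<open>\<parallel>C\<parallel> \<le> 1\<close> the iteration \<open>Y\<^sub>n\<^sub>+\<^sub>1 = (C + Y\<^sub>n\<^sup>2) / 2\<close> converges in norm, because its increments are
  dominated by those of the scalar iteration \<open>y\<^sub>n\<^sub>+\<^sub>1 = (1 + y\<^sub>n\<^sup>2) / 2\<close>.  The limit \<open>Y\<close> makes \<open>1 - Y\<close> a
  square root of \<open>1 - C\<close>; it inherits every closed property that the iteration preserves.
\<close>

lemma square_root_iteration:
  fixes C :: "'a::banach \<Rightarrow>\<^sub>L 'a"
  assumes C: "norm C \<le> 1"
  obtains Y where "norm Y \<le> 1" "2 *\<^sub>R Y = C + (Y o\<^sub>L Y)"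
    "\<forall>K. closed K \<longrightarrow> 0 \<in> K \<longrightarrow> (\<forall>Z\<in>K. (1/2) *\<^sub>R (C + (Z o\<^sub>L Z)) \<in> K) \<longrightarrow> Y \<in> K"
proof -
  define X where "X = rec_nat (0 :: 'a \<Rightarrow>\<^sub>L 'a) (\<lambda>_ Z. (1/2) *\<^sub>R (C + (Z o\<^sub>L Z)))"
  define y where "y = rec_nat (0::real) (\<lambda>_ z. (1/2) * (1 + z * z))"
  have X: "X 0 = 0" "\<And>n. X (Suc n) = (1/2) *\<^sub>R (C + (X n o\<^sub>L X n))" by (simp_all add: X_def)
  have y: "y 0 = 0" "\<And>n. y (Suc n) = (1/2) * (1 + y n * y n)" by (simp_all add: y_def)
  have y01: "0 \<le> y n \<and> y n \<le> 1" for n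
  proof (induction n)
    case (Suc n)
    then have "y n * y n \<le> 1" by (simp add: mult_le_one)
    with Suc show ?case by (simp add: y)
  qed (simp add: y)
  have Xy: "norm (X n) \<le> y n" for n
  proof (induction n)
    case (Suc n)
    have "norm (X n o\<^sub>L X n) \<le> y n * y n"
      using norm_blinfun_compose[of "X n" "X n"] mult_mono[OF Suc Suc] y01[of n] by auto
    then have "norm (C + (X n o\<^sub>L X n)) \<le> 1 + y n * y n"
      using norm_triangle_ineq[of C "X n o\<^sub>L X n"] C by linarith
    then show ?case by (simp add: X y)
  qed (simp add: X y)
  have incr: "norm (X (Suc n) - X n) \<le> y (Suc n) - y n" for n
  proof (induction n)
    case 0
    show ?case using C by (simp add: X y bounded_bilinear.zero_left[OF bounded_bilinear_blinfun_compose])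
  next
    case (Suc n)
    define d where "d = X (Suc n) - X n"
    \<comment> \<open>This splitting of a difference of squares needs no commutation of the
      iterates, and each term is bounded by the matching scalar term.\<close>
    have "(X (Suc n) o\<^sub>L X (Suc n)) - (X n o\<^sub>L X n) = (X (Suc n) o\<^sub>L d) + (d o\<^sub>L X n)"
      by (simp add: d_def bounded_bilinear.diff_left[OF bounded_bilinear_blinfun_compose]
          bounded_bilinear.diff_right[OF bounded_bilinear_blinfun_compose])
    then have "X (Suc (Suc n)) - X (Suc n) = (1/2) *\<^sub>R ((X (Suc n) o\<^sub>L d) + (d o\<^sub>L X n))"
      unfolding X(2)[of "Suc n"]
      by (subst (2) X(2)) (simp only: scaleR_diff_right[symmetric] add_diff_cancel_left)
    moreover have "norm (X (Suc n) o\<^sub>L d) \<le> y (Suc n) * (y (Suc n) - y n)"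
      using norm_blinfun_compose[of "X (Suc n)" d] mult_mono[OF Xy[of "Suc n"] Suc] y01[of "Suc n"]
      by (auto simp: d_def)
    moreover have "norm (d o\<^sub>L X n) \<le> (y (Suc n) - y n) * y n"
      using norm_blinfun_compose[of d "X n"] mult_mono[OF Suc Xy[of n]] order_trans[OF norm_ge_zero Suc]
      by (auto simp: d_def)
    ultimately have "norm (X (Suc (Suc n)) - X (Suc n))
        \<le> (1/2) * (y (Suc n) * (y (Suc n) - y n) + (y (Suc n) - y n) * y n)"
      using norm_triangle_ineq[of "X (Suc n) o\<^sub>L d" "d o\<^sub>L X n"] by simp
    also have "\<dots> = y (Suc (Suc n)) - y (Suc n)"
      by (simp add: y(2)[of "Suc n"] y(2)[of n] algebra_simps)
    finally show ?case .
  qed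
  have "0 \<le> y (Suc n) - y n" for n by (rule order_trans[OF norm_ge_zero incr])
  \<comment> \<open>The scalar sequence increases and stays below 1, so its telescoping increments
    are summable and majorize those of \<open>X\<close>.\<close>
  then have "incseq y" by (intro incseq_SucI) simp
  then obtain L where "y \<longlonglongrightarrow> L" using y01 by (metis incseq_convergent)
  then have "summable (\<lambda>n. y (Suc n) - y n)" by (rule telescope_summable)
  then have "summable (\<lambda>n. X (Suc n) - X n)"
    by (rule summable_comparison_test'[where N = 0]) (rule incr)
  then have "convergent (\<lambda>n. X n - X 0)"
    by (simp add: summable_iff_convergent sum_lessThan_telescope)
  then obtain Y where lim: "X \<longlonglongrightarrow> Y" by (auto simp: convergent_def X)
  have "(\<lambda>n. (1/2) *\<^sub>R (C + (X n o\<^sub>L X n))) \<longlonglongrightarrow> (1/2) *\<^sub>R (C + (Y o\<^sub>L Y))"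
    by (intro tendsto_intros lim bounded_bilinear.tendsto[OF bounded_bilinear_blinfun_compose])
  then have Y_eq: "Y = (1/2) *\<^sub>R (C + (Y o\<^sub>L Y))"
    using LIMSEQ_unique[OF LIMSEQ_Suc[OF lim, unfolded X]] by blast
  show ?thesis
  proof
    show "norm Y \<le> 1"
      using Lim_bounded[OF tendsto_norm[OF lim], of 0 1] Xy y01 order_trans by blast
    show "2 *\<^sub>R Y = C + (Y o\<^sub>L Y)" by (subst Y_eq) simp
    show "\<forall>K. closed K \<longrightarrow> 0 \<in> K \<longrightarrow> (\<forall>Z\<in>K. (1/2) *\<^sub>R (C + (Z o\<^sub>L Z)) \<in> K) \<longrightarrow> Y \<in> K"
    proof (intro allI impI)
      fix K assume K: "closed K" "0 \<in> K" "\<forall>Z\<in>K. (1/2) *\<^sub>R (C + (Z o\<^sub>L Z)) \<in> K"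
      have "X n \<in> K" for n by (induction n) (use K in \<open>simp_all add: X\<close>)
      then show "Y \<in> K" using K(1) lim by (auto intro: closed_sequentially)
    qed
  qed
qed

context real_hilbert
begin

text \<open>
  \<open>Q\<close> projects onto the kernel of \<open>R + B\<close> with \<open>R = (B\<^sup>2)\<^sup>1\<^sup>/\<^sup>2\<close>; on that kernel \<open>B = -R\<close>, on
  its complement \<open>B = R\<close> because \<open>(R + B) (R - B) = 0\<close>.
\<close>

lemma bounded_sign_splitting:
  assumes B: "bounded_linear B" "sym B" and le: "\<And>x. norm (B x) \<le> norm x"
  obtains Q where "projection Q"
    "\<And>x. Q x = x \<Longrightarrow> \<langle>B x, x\<rangle> \<le> 0"
    "\<And>x. Q x = 0 \<Longrightarrow> 0 \<le> \<langle>B x, x\<rangle>"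
    "\<And>x. Q x = 0 \<Longrightarrow> \<langle>B x, x\<rangle> = 0 \<Longrightarrow> x = 0"
    "\<And>P x. bounded_linear P \<Longrightarrow> sym P \<Longrightarrow> (\<And>x. P (B x) = B (P x)) \<Longrightarrow> P (Q x) = Q (P x)"
proof -
  interpret B: bounded_linear B by fact
  have symB: "\<langle>B x, y\<rangle> = \<langle>x, B y\<rangle>" for x y using B(2) unfolding sym_def by blast
  \<comment> \<open>With \<open>C = 1 - B\<^sup>2\<close> the fixed point equation for
    \<open>Y\<close> says that \<open>1 - Y\<close> squares to \<open>B\<^sup>2\<close>.\<close>
  define C where "C = Blinfun (\<lambda>x. x - B (B x))"
  have C: "blinfun_apply C x = x - B (B x)" for x
    unfolding C_def by (subst bounded_linear_Blinfun_apply)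
      (auto intro!: bounded_linear_sub bounded_linear_ident bounded_linear_compose[OF B(1) B(1)])
  have "norm C \<le> 1"
  proof (rule norm_blinfun_bound)
    fix x
    have "(norm (x - B (B x)))\<^sup>2 = (norm x)\<^sup>2 - 2 * (norm (B x))\<^sup>2 + (norm (B (B x)))\<^sup>2"
      by (simp add: norm_diff_sq symB[symmetric] self)
    moreover have "(norm (B (B x)))\<^sup>2 \<le> (norm (B x))\<^sup>2" using le[of "B x"] by (simp add: power_mono)
    ultimately have "(norm (x - B (B x)))\<^sup>2 \<le> (norm x)\<^sup>2"
      using zero_le_power2[of "norm (B x)"] by linarith
    then have "norm (x - B (B x)) \<le> norm x" by (rule power2_le_imp_le) simp
    then show "norm (blinfun_apply C x) \<le> 1 * norm x" by (simp add: C)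
  qed simp
  then obtain Y where Y: "norm Y \<le> 1" "2 *\<^sub>R Y = C + (Y o\<^sub>L Y)"
    and K: "\<forall>K. closed K \<longrightarrow> 0 \<in> K \<longrightarrow> (\<forall>Z\<in>K. (1/2) *\<^sub>R (C + (Z o\<^sub>L Z)) \<in> K) \<longrightarrow> Y \<in> K"
    by (rule square_root_iteration)
  have closed_prop: "\<And>K. closed K \<Longrightarrow> 0 \<in> K \<Longrightarrow> (\<And>Z. Z \<in> K \<Longrightarrow> (1/2) *\<^sub>R (C + (Z o\<^sub>L Z)) \<in> K) \<Longrightarrow> Y \<in> K" for K
    using K by blast
  interpret Y: bounded_linear "blinfun_apply Y" by (rule blinfun.bounded_linear_right)
  have "Y \<in> {Z. \<forall>x y. \<langle>blinfun_apply Z x, y\<rangle> = \<langle>x, blinfun_apply Z y\<rangle>}"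
  proof (rule closed_prop)
    show "closed {Z. \<forall>x y. \<langle>blinfun_apply Z x, y\<rangle> = \<langle>x, blinfun_apply Z y\<rangle>}"
      by (intro closed_Collect_all closed_Collect_eq continuous_on continuous_intros blinfun.continuous_on)
  qed (simp_all add: C bilin blinfun.bilinear_simps symB zero_left zero_right)
  then have symY: "\<langle>Y x, y\<rangle> = \<langle>x, Y y\<rangle>" for x y by simp
  have comm: "P (Y x) = Y (P x)"
    if P: "bounded_linear P" and PB: "\<And>x. P (B x) = B (P x)" for P x
  proof -
    interpret P: bounded_linear P by fact
    have "Y \<in> {Z. \<forall>x. P (blinfun_apply Z x) = blinfun_apply Z (P x)}"
    proof (rule closed_prop)
      show "closed {Z. \<forall>x. P (blinfun_apply Z x) = blinfun_apply Z (P x)}"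
        by (intro closed_Collect_all closed_Collect_eq P.continuous_on continuous_intros blinfun.continuous_on)
    qed (simp_all add: C blinfun.bilinear_simps P.add P.diff P.scaleR PB)
    then show ?thesis by simp
  qed
  define R where "R = (\<lambda>x. x - Y x)"
  have R: "bounded_linear R" unfolding R_def by (intro bounded_linear_intros Y.bounded_linear_axioms)
  interpret R: bounded_linear R by fact
  have symR: "\<langle>R x, y\<rangle> = \<langle>x, R y\<rangle>" for x y by (simp add: R_def bilin symY)
  have commR: "P (R x) = R (P x)" if "bounded_linear P" "\<And>x. P (B x) = B (P x)" for P x
    using comm[OF that] linear_diff[OF bounded_linear.linear[OF that(1)]] by (simp add: R_def)
  have RR: "R (R x) = B (B x)" for x
  proof -
    have "2 *\<^sub>R Y x = x - B (B x) + Y (Y x)"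
      using arg_cong[OF Y(2), of "\<lambda>Z. blinfun_apply Z x"] by (simp add: blinfun.bilinear_simps C)
    then show ?thesis by (simp add: R_def Y.diff scaleR_2 algebra_simps)
  qed
  have YI: "\<langle>Y x, x\<rangle> \<le> (norm x)\<^sup>2" "norm (Y x) \<le> norm x" for x
  proof -
    show *: "norm (Y x) \<le> norm x" using norm_blinfun[of Y x] Y(1) mult_right_mono[OF Y(1), of "norm x"] by simp
    show "\<langle>Y x, x\<rangle> \<le> (norm x)\<^sup>2"
      using cauchy_schwarz[of "Y x" x] mult_right_mono[OF *, of "norm x"] by (simp add: power2_eq_square)
  qed
  have Rpos: "0 \<le> \<langle>R x, x\<rangle>" for x using YI(1)[of x] by (simp add: R_def bilin self)
  \<comment> \<open>If the form of \<open>R\<close> vanishes at \<open>x\<close>, then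
    \<open>\<langle>x, Y x\<rangle> = (norm x)\<^sup>2\<close> although
    \<open>norm (Y x) \<le> norm x\<close>: the equality case of Cauchy-Schwarz, which gives
    \<open>Y x = x\<close>.\<close>
  have R0: "R x = 0" if "\<langle>R x, x\<rangle> = 0" for x
  proof -
    have "\<langle>x, Y x\<rangle> = (norm x)\<^sup>2" using that commute[of x "Y x"] by (simp add: R_def bilin self)
    moreover have "(norm (Y x))\<^sup>2 \<le> (norm x)\<^sup>2" using YI(2)[of x] by (simp add: power_mono)
    ultimately have "(norm (x - Y x))\<^sup>2 \<le> 0" unfolding norm_diff_sq by linarith
    then show ?thesis by (simp add: R_def)
  qed
  define N where "N = {x. R x + B x = 0}"
  have "subspace N" by (auto simp: N_def subspace_def R.zero B.zero R.add B.add R.scaleR B.scaleR add_eq_0_iff2)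
  moreover have "closed N"
    unfolding N_def by (intro closed_Collect_eq continuous_intros R.continuous_on B.continuous_on)
  ultimately obtain Q where Q: "projection Q" "range Q = N" by (rule projection_onto)
  have QN: "Q x = x \<longleftrightarrow> x \<in> N" for x using proj_range_iff[OF Q(1)] Q(2) by blast
  have BN: "B x = - R x" if "Q x = x" for x
    using QN[of x] that by (simp add: N_def add_eq_0_iff)
  have BNc: "B x = R x" if "Q x = 0" for x
  proof -
    \<comment> \<open>\<open>R - B\<close> maps into \<open>N\<close>, to which \<open>x\<close> is
      orthogonal; moving \<open>R - B\<close> to the other side by symmetry gives
      \<open>B x = R x\<close>.\<close>
    have "R (B z) = B (R z)" for z by (rule commR[symmetric]) (simp_all add: B)
    then have "R z - B z \<in> N" for z by (simp add: N_def R.diff B.diff RR)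
    then have "\<langle>x, R z - B z\<rangle> = 0" for z using proj_orth[OF Q(1), of "R z - B z" x] QN that by simp
    then show ?thesis by (intro eqI) (simp add: bilin symR symB)
  qed
  show ?thesis
  proof
    show "projection Q" by fact
    show "\<langle>B x, x\<rangle> \<le> 0" if "Q x = x" for x using BN[OF that] Rpos[of x] by (simp add: bilin)
    show "0 \<le> \<langle>B x, x\<rangle>" if "Q x = 0" for x using BNc[OF that] Rpos[of x] by simp
    \<comment> \<open>Vectors killed by both \<open>R\<close> and \<open>B\<close> belong to
      \<open>N\<close>, hence to the range of \<open>Q\<close>; this makes positivity on the kernel
      strict.\<close>
    show "x = 0" if "Q x = 0" "\<langle>B x, x\<rangle> = 0" for x
    proof -
      have "R x = 0" using that(2) BNc[OF that(1)] by (intro R0) simp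
      then have "x \<in> N" using BNc[OF that(1)] by (simp add: N_def)
      then show ?thesis using QN[of x] that(1) by simp
    qed
    show "P (Q x) = Q (P x)" if P: "bounded_linear P" "sym P" and PB: "\<And>x. P (B x) = B (P x)" for P x
    proof -
      have symP: "\<langle>P x, y\<rangle> = \<langle>x, P y\<rangle>" for x y using P(2) unfolding sym_def by blast
      have "P y \<in> N" if "y \<in> N" for y
        using that linear_add[OF bounded_linear.linear[OF P(1)], of "R y" "B y"]
          linear_0[OF bounded_linear.linear[OF P(1)]] commR[OF P(1) PB, of y] PB[of y] by (simp add: N_def)
      \<comment> \<open>Invariance of the range gives \<open>Q P Q = P Q\<close>; the adjoint
        equation is \<open>Q P Q = Q P\<close>, so the two products agree.\<close>
      then have *: "Q (P (Q y)) = P (Q y)" for y using Q(2) QN by blast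
      show ?thesis
      proof (rule eqI)
        fix z
        have "\<langle>P (Q x), z\<rangle> = \<langle>Q (P (Q x)), z\<rangle>" by (simp add: *)
        also have "\<dots> = \<langle>x, Q (P (Q z))\<rangle>" by (simp only: proj_sym[OF Q(1)] symP)
        also have "\<dots> = \<langle>Q (P x), z\<rangle>" by (simp only: * proj_sym[OF Q(1)] symP)
        finally show "\<langle>P (Q x), z\<rangle> = \<langle>Q (P x), z\<rangle>" .
      qed
    qed
  qed
qed

text \<open>Here \<open>incr\<close> is the Pythagorean identity for nested projections of one
  vector; it hands the Cauchy property of the bounded monotone numbers
  \<open>(norm (X n))\<^sup>2\<close> on to \<open>X\<close>. Used for decreasing spectral
  projections and for increasing truncations.\<close>

lemma monotone_norm_convergent:
  assumes mono: "monoseq (\<lambda>n. (norm (X n))\<^sup>2)" and bound: "\<And>n. norm (X n) \<le> K"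
    and incr: "\<And>m n. (norm (X m - X n))\<^sup>2 = \<bar>(norm (X m))\<^sup>2 - (norm (X n))\<^sup>2\<bar>"
  shows "convergent (X :: nat \<Rightarrow> 'h)"
proof -
  have "Bseq (\<lambda>n. (norm (X n))\<^sup>2)"
    using power_mono[OF bound norm_ge_zero, where n = 2] by (intro BseqI'[of _ "K\<^sup>2"]) simp
  then have "convergent (\<lambda>n. (norm (X n))\<^sup>2)" using mono by (rule Bseq_monoseq_convergent)
  then have cauchy: "Cauchy (\<lambda>n. (norm (X n))\<^sup>2)" by (rule convergent_Cauchy)
  have "Cauchy X"
  proof (rule metric_CauchyI)
    fix e :: real assume e: "0 < e"
    then obtain N where N: "\<forall>m\<ge>N. \<forall>n\<ge>N. dist ((norm (X m))\<^sup>2) ((norm (X n))\<^sup>2) < e\<^sup>2"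
      using metric_CauchyD[OF cauchy, of "e\<^sup>2"] by auto
    have "dist (X m) (X n) < e" if "m \<ge> N" "n \<ge> N" for m n
    proof -
      have "(norm (X m - X n))\<^sup>2 < e\<^sup>2" using N that by (simp add: incr dist_real_def)
      then have "norm (X m - X n) < e" by (rule power2_less_imp_less) (use e in simp)
      then show ?thesis by (simp add: dist_norm)
    qed
    then show "\<exists>N. \<forall>m\<ge>N. \<forall>n\<ge>N. dist (X m) (X n) < e" by blast
  qed
  then show ?thesis by (simp add: Cauchy_convergent_iff)
qed

text \<open>Polarization. It is confined to a subspace because it will be applied to
  \<open>A - c\<close> on a piece of the domain where the form is controlled.\<close>

lemma bound_of_form_bound:
  assumes V: "subspace V" and S: "\<And>v w. v \<in> V \<Longrightarrow> w \<in> V \<Longrightarrow> S (v + w) = S v + S w"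
      "\<And>v r. v \<in> V \<Longrightarrow> S (r *\<^sub>R v) = r *\<^sub>R S v"
    and sym: "\<And>v w. v \<in> V \<Longrightarrow> w \<in> V \<Longrightarrow> \<langle>S v, w\<rangle> = \<langle>v, S w\<rangle>"
    and form: "\<And>v. v \<in> V \<Longrightarrow> \<bar>\<langle>S v, v\<rangle>\<bar> \<le> r * (norm v)\<^sup>2"
    and vw: "v \<in> V" "w \<in> V"
  shows "\<langle>S v, w\<rangle> \<le> r * norm v * norm w"
proof (cases "v = 0 \<or> w = 0")
  case True
  have "S 0 = 0" using S(2)[of 0 0] subspace_0[OF V] by simp
  then show ?thesis using True by (auto simp: zero_left zero_right)
next
  case False
  \<comment> \<open>Rescaling \<open>w\<close> to the norm of \<open>v\<close> makes the
    parallelogram law return \<open>4 * (r * (norm v)\<^sup>2)\<close>, so the constant stays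
    \<open>r\<close>.\<close>
  define t where "t = norm v / norm w"
  define u where "u = t *\<^sub>R w"
  have t: "0 < t" using False by (simp add: t_def)
  have u: "u \<in> V" using V vw by (simp add: u_def subspace_scale)
  have nu: "norm u = norm v" using False by (simp add: u_def t_def)
  have neg: "(-1) *\<^sub>R u \<in> V" using V u by (rule subspace_scale)
  have "S (v - u) = S v - S u" using S(1)[OF vw(1) neg] S(2)[OF u, of "-1"] by simp
  moreover have "S (v + u) = S v + S u" using S(1) vw u by simp
  moreover have "\<langle>S u, v\<rangle> = \<langle>S v, u\<rangle>" using sym[OF u vw(1)] commute[of u "S v"] by simp
  ultimately have "4 * \<langle>S v, u\<rangle> = \<langle>S (v + u), v + u\<rangle> - \<langle>S (v - u), v - u\<rangle>"
    by (simp add: bilin)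
  also have "\<dots> \<le> r * (norm (v + u))\<^sup>2 + r * (norm (v - u))\<^sup>2"
    using form[of "v + u"] form[of "v - u"] vw(1) u V by (simp add: subspace_add subspace_diff abs_le_iff)
  also have "\<dots> = 4 * (r * (norm v)\<^sup>2)"
    unfolding norm_add_sq norm_diff_sq nu by (simp add: algebra_simps)
  finally have "t * \<langle>S v, w\<rangle> \<le> r * (norm v)\<^sup>2" by (simp add: u_def scaleR_right)
  also have "\<dots> = t * (r * norm v * norm w)"
    using False by (simp add: t_def power2_eq_square)
  finally show ?thesis using t by simp
qed

text \<open>Projections are contractions, so strong convergence transfers from \<open>D\<close>, the
  place where estimates involving \<open>A\<close> make sense.\<close>

lemma projections_tendsto_dense:
  assumes P: "\<And>i. projection (P i)" and Q: "projection Q" and D: "closure D = UNIV"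
    and lim: "\<And>x. x \<in> D \<Longrightarrow> ((\<lambda>i. P i x) \<longlongrightarrow> Q x) F"
  shows "((\<lambda>i. P i x) \<longlongrightarrow> Q x) F"
proof (rule tendstoI)
  fix e :: real assume e: "0 < e"
  have "x \<in> closure D" using D by simp
  then obtain d where d: "d \<in> D" "dist d x < e / 3"
    unfolding closure_approachable using e by (metis divide_pos_pos zero_less_numeral)
  have "\<forall>\<^sub>F i in F. dist (P i d) (Q d) < e / 3" by (rule tendstoD[OF lim[OF d(1)]]) (use e in simp)
  then show "\<forall>\<^sub>F i in F. dist (P i x) (Q x) < e"
  proof eventually_elim
    case (elim i)
    have "dist (P i x) (P i d) \<le> dist x d"
      using proj_norm_le[OF P, of i "x - d"] by (simp add: dist_norm proj_diff[OF P])
    moreover have "dist (Q d) (Q x) \<le> dist d x"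
      using proj_norm_le[OF Q, of "d - x"] by (simp add: dist_norm proj_diff[OF Q])
    ultimately show ?case
      using elim d(2) dist_triangle[of "P i x" "Q x" "P i d"] dist_triangle[of "P i d" "Q x" "Q d"]
        dist_commute[of x d] by linarith
  qed
qed

lemma projection_zero: "projection (\<lambda>x. 0)" and projection_id: "projection (\<lambda>x. x)"
  by (simp_all add: projection_def sym_def zero_left zero_right)

end

section \<open>Self-adjoint operators\<close>

text \<open>Symmetry and maximality of the domain express self-adjointness without the definite
  description in \<open>adjoint_op\<close>; the value of the adjoint is recovered in
  \<open>adjointD\<close>.\<close>

locale real_self_adjoint = real_hilbert ip
  for ip :: "'h::banach \<Rightarrow> 'h \<Rightarrow> real" (\<open>\<langle>_, _\<rangle>\<close>) +
  fixes D :: "'h set" and A :: "'h \<Rightarrow> 'h"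
  assumes D_subspace: "subspace D" and D_dense: "closure D = UNIV"
    and A_add: "x \<in> D \<Longrightarrow> y \<in> D \<Longrightarrow> A (x + y) = A x + A y"
    and A_scale: "x \<in> D \<Longrightarrow> A (r *\<^sub>R x) = r *\<^sub>R A x"
    and A_sym: "x \<in> D \<Longrightarrow> y \<in> D \<Longrightarrow> \<langle>A x, y\<rangle> = \<langle>x, A y\<rangle>"
    and adjoint_domain_subset: "(\<And>x. x \<in> D \<Longrightarrow> \<langle>A x, y\<rangle> = \<langle>x, z\<rangle>) \<Longrightarrow> y \<in> D"
begin

lemmas D_add = subspace_add[OF D_subspace]
  and D_diff = subspace_diff[OF D_subspace]
  and D_scale = subspace_scale[OF D_subspace]
  and D_0 = subspace_0[OF D_subspace]
  and D_neg = subspace_neg[OF D_subspace]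

lemma A_neg: "x \<in> D \<Longrightarrow> A (- x) = - A x"
  using A_scale[of x "-1"] by simp

lemma A_diff: "x \<in> D \<Longrightarrow> y \<in> D \<Longrightarrow> A (x - y) = A x - A y"
  using A_add[of x "- y"] A_neg[of y] D_neg[of y] by simp

lemma A_0: "A 0 = 0"
  using A_scale[of 0 0] D_0 by simp

lemma dense_orth: "(\<And>y. y \<in> D \<Longrightarrow> \<langle>x, y\<rangle> = 0) \<Longrightarrow> x = 0"
proof -
  assume "\<And>y. y \<in> D \<Longrightarrow> \<langle>x, y\<rangle> = 0"
  then have "\<langle>x, x\<rangle> = 0" using orth_closure[of x D x] D_dense by simp
  then show ?thesis by (simp add: self)
qed

lemma adjointD:
  assumes "\<And>x. x \<in> D \<Longrightarrow> \<langle>A x, y\<rangle> = \<langle>x, z\<rangle>"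
  shows "y \<in> D" "A y = z"
proof -
  show y: "y \<in> D" using assms by (rule adjoint_domain_subset)
  have "\<langle>A y - z, x\<rangle> = 0" if "x \<in> D" for x
    using assms[OF that] A_sym[OF that y] commute[of x "A y"] commute[of x z] by (simp add: diff_left)
  then show "A y = z" using dense_orth[of "A y - z"] by simp
qed

lemma closed_graph:
  assumes "\<And>n. u n \<in> D" and "u \<longlonglongrightarrow> x" and "(\<lambda>n. A (u n)) \<longlonglongrightarrow> y"
  shows "x \<in> D" "A x = y"
proof -
  have *: "\<langle>A w, x\<rangle> = \<langle>w, y\<rangle>" if "w \<in> D" for w
  proof -
    have "(\<lambda>n. \<langle>A w, u n\<rangle>) \<longlonglongrightarrow> \<langle>A w, x\<rangle>" by (intro tendsto tendsto_const assms)
    moreover have "(\<lambda>n. \<langle>w, A (u n)\<rangle>) \<longlonglongrightarrow> \<langle>w, y\<rangle>" by (intro tendsto tendsto_const assms)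
    ultimately show ?thesis using A_sym[OF that assms(1)] by (simp add: LIMSEQ_unique)
  qed
  show "x \<in> D" "A x = y" using adjointD[OF *] by blast+
qed

text \<open>The orthogonal complement of the graph of \<open>A\<close> is \<open>{(-A b, b) | b \<in> D}\<close>.\<close>

lemma graph_decomposition: "\<exists>a\<in>D. \<exists>b\<in>D. u = a - A b \<and> v = A a + b"
proof -
  define G where "G = (\<lambda>x. (x, A x)) ` D"
  have "subspace G"
    unfolding subspace_def
  proof (intro conjI ballI allI)
    show "0 \<in> G" using D_0 A_0 by (force simp: G_def zero_prod_def)
    show "p + q \<in> G" if "p \<in> G" "q \<in> G" for p q
      using that D_add A_add by (auto simp: G_def image_iff)
    show "c *\<^sub>R p \<in> G" if "p \<in> G" for c p
      using that D_scale A_scale by (auto simp: G_def image_iff)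
  qed
  moreover have "closed G"
    unfolding closed_sequential_limits
  proof safe
    fix p x y assume p: "\<forall>n. p n \<in> G" "p \<longlonglongrightarrow> (x, y)"
    have "fst q \<in> D \<and> A (fst q) = snd q" if "q \<in> G" for q using that by (auto simp: G_def)
    then have "\<And>n. fst (p n) \<in> D" "\<And>n. A (fst (p n)) = snd (p n)" using p(1) by blast+
    moreover have "(\<lambda>n. fst (p n)) \<longlonglongrightarrow> x" "(\<lambda>n. snd (p n)) \<longlonglongrightarrow> y"
      using tendsto_fst[OF p(2)] tendsto_snd[OF p(2)] by simp_all
    ultimately have "x \<in> D" "A x = y" using closed_graph[of "\<lambda>n. fst (p n)" x y] by simp_all
    then show "(x, y) \<in> G" by (auto simp: G_def)
  qed
  ultimately obtain a where a: "a \<in> D"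
    and orth: "\<forall>x\<in>D. \<langle>u - a, x\<rangle> + \<langle>v - A a, A x\<rangle> = 0"
    using real_hilbert.projection_exists[OF product_hilbert, of G "(u, v)"] by (auto simp: G_def)
  \<comment> \<open>Orthogonality of the residual \<open>(u - a, v - A a)\<close> to the graph is
    the adjoint relation for \<open>b = v - A a\<close>, with value \<open>a - u\<close>.\<close>
  have *: "\<langle>A x, v - A a\<rangle> = \<langle>x, a - u\<rangle>" if "x \<in> D" for x
    using orth[rule_format, OF that] commute[of "A x" "v - A a"] commute[of x "a - u"]
    by (simp add: diff_left)
  have "v - A a \<in> D" "A (v - A a) = a - u" using adjointD[OF *] by blast+
  then show ?thesis using a by (intro bexI[of _ a] bexI[of _ "v - A a"]) auto
qed

text \<open>The bounded operators \<open>(1 + A\<^sup>2)\<^sup>-\<^sup>1\<close> and \<open>A (1 + A\<^sup>2)\<^sup>-\<^sup>1\<close>.\<close>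

definition res :: "'h \<Rightarrow> 'h" where
  "res h = (SOME x. x \<in> D \<and> A x \<in> D \<and> x + A (A x) = h)"

definition tr :: "'h \<Rightarrow> 'h" where "tr h = A (res h)"

lemma res: "res h \<in> D" "tr h \<in> D" "res h + A (tr h) = h"
proof -
  \<comment> \<open>Decomposing \<open>(h, 0)\<close> gives \<open>A a = - b\<close>, which lies in
    \<open>D\<close>, and so \<open>h = a - A b = a + A (A a)\<close>.\<close>
  obtain a b where ab: "a \<in> D" "b \<in> D" "h = a - A b" "0 = A a + b"
    using graph_decomposition[of h 0] by blast
  then have "A a = - b" by (simp add: eq_neg_iff_add_eq_0)
  then have "a \<in> D \<and> A a \<in> D \<and> a + A (A a) = h" using ab D_neg A_neg by simp
  then have "res h \<in> D \<and> A (res h) \<in> D \<and> res h + A (A (res h)) = h" unfolding res_def by (rule someI)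
  then show "res h \<in> D" "tr h \<in> D" "res h + A (tr h) = h" by (simp_all add: tr_def)
qed

text \<open>A solution \<open>d\<close> of the homogeneous equation, paired with itself, gives
  \<open>(norm d)\<^sup>2 + (norm (A d))\<^sup>2 = 0\<close>. This pins down the vector chosen by
  \<open>SOME\<close>.\<close>

lemma res_eqI:
  assumes "x \<in> D" "A x \<in> D" "x + A (A x) = h"
  shows "res h = x" "tr h = A x"
proof -
  define d where "d = res h - x"
  have e: "(res h + A (tr h)) - (x + A (A x)) = 0" using assms(3) res(3)[of h] by simp
  have d: "d \<in> D" "A d \<in> D" "d + A (A d) = 0"
    using e assms(1,2) res(1,2)[of h] by (simp_all add: d_def A_diff D_diff tr_def algebra_simps)
  have "\<langle>d, d\<rangle> + \<langle>A d, A d\<rangle> = \<langle>d + A (A d), d\<rangle>"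
    using A_sym[OF d(2,1)] by (simp add: add_left)
  then have "(norm d)\<^sup>2 + (norm (A d))\<^sup>2 = 0" by (simp only: d(3) zero_left self)
  then have "d = 0" unfolding sum_power2_eq_zero_iff by simp
  then show "res h = x" by (simp add: d_def)
  then show "tr h = A x" by (simp add: tr_def)
qed

lemma res_sym: "\<langle>res h, k\<rangle> = \<langle>h, res k\<rangle>" and tr_sym: "\<langle>tr h, k\<rangle> = \<langle>h, tr k\<rangle>"
proof -
  have "\<langle>res h, res k + A (tr k)\<rangle> = \<langle>res h + A (tr h), res k\<rangle>"
    using A_sym[OF res(1)[of h] res(2)[of k]] A_sym[OF res(2)[of h] res(1)[of k]]
    by (simp add: bilin tr_def)
  then show "\<langle>res h, k\<rangle> = \<langle>h, res k\<rangle>" by (simp add: res)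
  have "\<langle>tr h, res k + A (tr k)\<rangle> = \<langle>res h + A (tr h), tr k\<rangle>"
    using A_sym[OF res(1)[of h] res(1)[of k]] A_sym[OF res(2)[of h] res(2)[of k]]
    by (simp add: bilin tr_def)
  then show "\<langle>tr h, k\<rangle> = \<langle>h, tr k\<rangle>" by (simp add: res)
qed

text \<open>In the expansion of \<open>h = res h + A (tr h)\<close> the cross term is
  \<open>2 * (norm (tr h))\<^sup>2\<close> by symmetry. Contractivity of \<open>tr\<close> is what
  \<open>bounded_sign_splitting\<close> asks for.\<close>

lemma res_tr_le: "(norm (res h))\<^sup>2 + 2 * (norm (tr h))\<^sup>2 \<le> (norm h)\<^sup>2"
proof -
  have "(norm h)\<^sup>2 = (norm (res h + A (tr h)))\<^sup>2" by (simp add: res)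
  also have "\<dots> = (norm (res h))\<^sup>2 + 2 * (norm (tr h))\<^sup>2 + (norm (A (tr h)))\<^sup>2"
    using A_sym[OF res(1)[of h] res(2)[of h]] by (simp add: norm_add_sq tr_def self)
  finally show ?thesis by simp
qed

lemma res_norm_le: "norm (res h) \<le> norm h" and tr_norm_le: "norm (tr h) \<le> norm h"
proof -
  have "(norm (res h))\<^sup>2 \<le> (norm h)\<^sup>2" "(norm (tr h))\<^sup>2 \<le> (norm h)\<^sup>2"
    using res_tr_le[of h] zero_le_power2[of "norm (res h)"] zero_le_power2[of "norm (tr h)"] by linarith+
  then show "norm (res h) \<le> norm h" "norm (tr h) \<le> norm h"
    by (auto dest: power2_le_imp_le)
qed

lemma sym_res: "sym res" and sym_tr: "sym tr"
  unfolding sym_def using res_sym tr_sym by blast+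

lemmas bounded_linear_res = sym_bounded_linear[OF sym_res res_norm_le]
  and bounded_linear_tr = sym_bounded_linear[OF sym_tr tr_norm_le]

lemma res_A:
  assumes "x \<in> D"
  shows "res (A x) = tr x" "tr (A x) = A (tr x)"
proof -
  have e: "A (tr x) = x - res x" using res(3)[of x] by (simp add: algebra_simps)
  then have "A (tr x) \<in> D" using assms res D_diff by simp
  moreover have "tr x + A (A (tr x)) = A x"
    using A_diff[OF assms res(1)[of x]] unfolding e by (simp add: tr_def)
  ultimately show "res (A x) = tr x" "tr (A x) = A (tr x)" using res_eqI[of "tr x" "A x"] res(2) by blast+
qed

lemma res_tr: "res (tr h) = tr (res h)"
  unfolding tr_def[of h] using res_A[OF res(1)] by simp

text \<open>For a projection this is the usual inclusion \<open>P A \<subseteq> A P\<close>: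
  \<open>D\<close> splits along range and kernel, and \<open>A\<close> respects both.\<close>

definition reduces :: "('h \<Rightarrow> 'h) \<Rightarrow> bool" where
  "reduces P \<longleftrightarrow> (\<forall>x\<in>D. P x \<in> D \<and> A (P x) = P (A x))"

lemma reducesD: "reduces P \<Longrightarrow> x \<in> D \<Longrightarrow> P x \<in> D" "reduces P \<Longrightarrow> x \<in> D \<Longrightarrow> A (P x) = P (A x)"
  unfolding reduces_def by blast+

lemma reduces_tr:
  assumes P: "projection P" and red: "reduces P"
  shows "P (tr h) = tr (P h)"
proof -
  have "A (P (res h)) = P (tr h)" "A (P (tr h)) = P (A (tr h))"
    using reducesD(2)[OF red res(1)[of h]] reducesD(2)[OF red res(2)[of h]] by (simp_all add: tr_def)
  moreover have "P (res h) + P (A (tr h)) = P h"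
    using proj_add[OF P, of "res h" "A (tr h)"] by (simp add: res)
  ultimately show ?thesis
    using res_eqI(2)[of "P (res h)" "P h"] reducesD(1)[OF red res(1)[of h]] reducesD(1)[OF red res(2)[of h]]
    by simp
qed

text \<open>Split \<open>(Q x, Q (A x))\<close> into \<open>(a, A a)\<close> and the complementary
  part \<open>(- A b, b)\<close>; the claim is \<open>b = 0\<close>. Testing \<open>b\<close>
  against \<open>k = res k + A (tr k)\<close> moves everything onto the bounded operators, which
  commute with \<open>Q\<close>.\<close>

lemma reduces_if_commutes:
  assumes Q: "projection Q" and r: "\<And>x. Q (res x) = res (Q x)" and t: "\<And>x. Q (tr x) = tr (Q x)"
  shows "reduces Q"
  unfolding reduces_def
proof safe
  fix x assume x: "x \<in> D"
  obtain a b where ab: "a \<in> D" "b \<in> D" "Q x = a - A b" "Q (A x) = A a + b"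
    using graph_decomposition[of "Q x" "Q (A x)"] by blast
  have "\<langle>b, k\<rangle> = 0" for k
  proof -
    have "\<langle>b, k\<rangle> = \<langle>b, res k + A (tr k)\<rangle>" by (simp add: res)
    also have "\<dots> = \<langle>b, res k\<rangle> + \<langle>A b, tr k\<rangle>"
      using A_sym[OF ab(2) res(2)[of k]] by (simp add: add_right)
    also have "\<dots> = \<langle>Q (A x) - A a, res k\<rangle> + \<langle>a - Q x, tr k\<rangle>" by (simp add: ab)
    also have "\<dots> = \<langle>A x, res (Q k)\<rangle> - \<langle>x, tr (Q k)\<rangle>"
      using A_sym[OF ab(1) res(1)[of k]] by (simp add: bilin proj_sym[OF Q] r t tr_def[symmetric])
    also have "\<dots> = 0" using A_sym[OF x res(1)[of "Q k"]] by (simp add: tr_def)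
    finally show ?thesis .
  qed
  then have "\<langle>b, b\<rangle> = 0" .
  then have "b = 0" by (simp add: self)
  then show "Q x \<in> D" "A (Q x) = Q (A x)" using ab A_0 by simp_all
qed

text \<open>
  The sign of \<open>A\<close> agrees with the sign of the bounded operator \<open>A (1 + A\<^sup>2)\<^sup>-\<^sup>1\<close>.
\<close>

lemma form_eq_tr: "x \<in> D \<Longrightarrow> \<langle>A x, x\<rangle> = \<langle>tr x, x\<rangle> + \<langle>tr (A x), A x\<rangle>"
proof -
  assume x: "x \<in> D"
  \<comment> \<open>With \<open>B = tr\<close> this is the identity \<open>A = B + A B A\<close>,
    read as a quadratic form on \<open>D\<close>.\<close>
  have "\<langle>A x, x\<rangle> = \<langle>A x, res x + A (tr x)\<rangle>" by (simp add: res)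
  also have "\<dots> = \<langle>res (A x), x\<rangle> + \<langle>A x, tr (A x)\<rangle>"
    by (simp only: add_right res_sym res_A(2)[OF x])
  finally show ?thesis using commute[of "A x" "tr (A x)"] by (simp add: res_A[OF x])
qed

text \<open>A reducing projection keeps \<open>x\<close> and \<open>A x\<close> in the same summand,
  so both terms of \<open>form_eq_tr\<close> have the same sign there. \<open>Q\<close> reduces
  \<open>A\<close> because \<open>res\<close> and \<open>tr\<close> commute with \<open>tr\<close>
  and therefore with \<open>Q\<close>.\<close>

lemma sign_splitting:
  "\<exists>Q. projection Q \<and> reduces Q \<and> (\<forall>x\<in>D. Q x = x \<longrightarrow> \<langle>A x, x\<rangle> \<le> 0) \<and>
     (\<forall>x\<in>D. Q x = 0 \<longrightarrow> x \<noteq> 0 \<longrightarrow> 0 < \<langle>A x, x\<rangle>) \<and>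
     (\<forall>P. projection P \<longrightarrow> reduces P \<longrightarrow> (\<forall>x. P (Q x) = Q (P x)))"
proof (rule bounded_sign_splitting[OF bounded_linear_tr sym_tr tr_norm_le])
  fix Q assume Q: "projection Q"
    and neg: "\<And>x. Q x = x \<Longrightarrow> \<langle>tr x, x\<rangle> \<le> 0"
    and pos: "\<And>x. Q x = 0 \<Longrightarrow> 0 \<le> \<langle>tr x, x\<rangle>"
    and pos': "\<And>x. Q x = 0 \<Longrightarrow> \<langle>tr x, x\<rangle> = 0 \<Longrightarrow> x = 0"
    and comm: "\<And>P x. bounded_linear P \<Longrightarrow> sym P \<Longrightarrow> (\<And>x. P (tr x) = tr (P x)) \<Longrightarrow> P (Q x) = Q (P x)"
  have red: "reduces Q"
    using comm[OF bounded_linear_res sym_res res_tr] comm[OF bounded_linear_tr sym_tr refl]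
    by (intro reduces_if_commutes[OF Q]) simp_all
  show ?thesis
  proof (intro exI[of _ Q] conjI ballI allI impI)
    fix x assume x: "x \<in> D" "Q x = x"
    then show "\<langle>A x, x\<rangle> \<le> 0"
      using neg[of x] neg[of "A x"] reducesD(2)[OF red x(1)] form_eq_tr[OF x(1)] by simp
  next
    fix x assume x: "x \<in> D" "Q x = 0" "x \<noteq> 0"
    then have "Q (A x) = 0" using reducesD(2)[OF red x(1)] A_0 by simp
    moreover have "\<langle>tr x, x\<rangle> \<noteq> 0" using pos'[OF x(2)] x(3) by blast
    ultimately show "0 < \<langle>A x, x\<rangle>"
      using pos[of x] pos[of "A x"] form_eq_tr[OF x(1)] x(2) by linarith
  next
    fix P x assume "projection P" "reduces P"
    then show "P (Q x) = Q (P x)"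
      using comm[of P x] proj_bounded_linear reduces_tr unfolding projection_def by blast
  qed (fact Q red)+
qed

section \<open>Cutting a self-adjoint operator at a level\<close>

lemma shift: "real_self_adjoint ip D (\<lambda>x. A x - l *\<^sub>R x)"
proof
  show "y \<in> D" if "\<And>x. x \<in> D \<Longrightarrow> \<langle>A x - l *\<^sub>R x, y\<rangle> = \<langle>x, z\<rangle>" for y z
  proof (rule adjoint_domain_subset)
    show "\<langle>A x, y\<rangle> = \<langle>x, z + l *\<^sub>R y\<rangle>" if "x \<in> D" for x
      using \<open>\<And>x. x \<in> D \<Longrightarrow> \<langle>A x - l *\<^sub>R x, y\<rangle> = \<langle>x, z\<rangle>\<close>[OF that] by (simp add: bilin)
  qed
qed (simp_all add: D_subspace D_dense A_add A_scale A_sym bilin algebra_simps)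

definition splits :: "real \<Rightarrow> ('h \<Rightarrow> 'h) \<Rightarrow> bool" where
  "splits l Q \<longleftrightarrow> projection Q \<and> reduces Q \<and> (\<forall>x\<in>D. Q x = x \<longrightarrow> \<langle>A x, x\<rangle> \<le> l * (norm x)\<^sup>2) \<and>
     (\<forall>x\<in>D. Q x = 0 \<longrightarrow> x \<noteq> 0 \<longrightarrow> l * (norm x)\<^sup>2 < \<langle>A x, x\<rangle>)"

lemma splits_exists:
  "\<exists>Q. splits l Q \<and> (\<forall>P. projection P \<longrightarrow> reduces P \<longrightarrow> (\<forall>x. P (Q x) = Q (P x)))"
proof -
  interpret S: real_self_adjoint ip D "\<lambda>x. A x - l *\<^sub>R x" by (rule shift)
  have red: "S.reduces P \<longleftrightarrow> reduces P" if P: "projection P" for P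
    unfolding S.reduces_def reduces_def by (simp add: proj_diff[OF P] proj_scale[OF P])
  have form: "\<langle>A x - l *\<^sub>R x, x\<rangle> = \<langle>A x, x\<rangle> - l * (norm x)\<^sup>2" for x by (simp add: bilin self)
  obtain Q where Q: "projection Q" "S.reduces Q"
     "\<forall>x\<in>D. Q x = x \<longrightarrow> \<langle>A x, x\<rangle> - l * (norm x)\<^sup>2 \<le> 0"
     "\<forall>x\<in>D. Q x = 0 \<longrightarrow> x \<noteq> 0 \<longrightarrow> 0 < \<langle>A x, x\<rangle> - l * (norm x)\<^sup>2"
     "\<forall>P. projection P \<longrightarrow> S.reduces P \<longrightarrow> (\<forall>x. P (Q x) = Q (P x))"
    using S.sign_splitting unfolding form by (elim exE conjE) (rule that)
  have "splits l Q" using Q(1-4) red[OF Q(1)] unfolding splits_def by (simp add: less_diff_eq)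
  moreover have "\<forall>P. projection P \<longrightarrow> reduces P \<longrightarrow> (\<forall>x. P (Q x) = Q (P x))"
    using Q(5) by (simp add: red)
  ultimately show ?thesis by (intro exI conjI)
qed

lemma splitsD:
  assumes "splits l Q"
  shows "projection Q" "reduces Q" "x \<in> D \<Longrightarrow> Q x = x \<Longrightarrow> \<langle>A x, x\<rangle> \<le> l * (norm x)\<^sup>2"
    "x \<in> D \<Longrightarrow> Q x = 0 \<Longrightarrow> x \<noteq> 0 \<Longrightarrow> l * (norm x)\<^sup>2 < \<langle>A x, x\<rangle>"
  using assms unfolding splits_def by blast+

text \<open>\<open>R\<close> sends the dense set \<open>D\<close> to vectors of \<open>D\<close>
  that it fixes, so it vanishes on \<open>D\<close> and by continuity everywhere.\<close>

lemma reducing_projection_zero: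
  assumes R: "projection R" "reduces R" and zero: "\<And>x. x \<in> D \<Longrightarrow> R x = x \<Longrightarrow> x = 0"
  shows "R x = 0"
proof -
  have "R x = 0" if "x \<in> D" for x
    using zero[OF reducesD(1)[OF R(2) that]] proj_idem[OF R(1)] by simp
  moreover have "closed {x. R x = 0}"
    by (intro closed_Collect_eq bounded_linear.continuous_on[OF proj_bounded_linear[OF R(1)]] continuous_intros)
  ultimately have "closure D \<subseteq> {x. R x = 0}" by (intro closure_minimal) auto
  then show ?thesis using D_dense by blast
qed

text \<open>\<open>P (1 - Q)\<close> projects onto the range of \<open>P\<close> intersected with
  the kernel of \<open>Q\<close>; a nonzero \<open>y\<close> of \<open>D\<close> there would satisfy
  \<open>m * (norm y)\<^sup>2 < \<langle>A y, y\<rangle> \<le> l * (norm y)\<^sup>2\<close>.\<close>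

lemma splits_mono:
  assumes "l \<le> m" and P: "splits l P" and Q: "splits m Q" and comm: "\<And>x. P (Q x) = Q (P x)"
  shows "Q (P x) = P x"
proof -
  note P' = splitsD(1)[OF P] and Q' = splitsD(1)[OF Q]
  have "projection (\<lambda>x. P (x - Q x))"
    using projection_comp[OF P' projection_compl[OF Q']] by (simp add: proj_diff[OF P'] comm)
  moreover have "reduces (\<lambda>x. P (x - Q x))"
    unfolding reduces_def
    by (auto simp: reducesD[OF splitsD(2)[OF P]] reducesD[OF splitsD(2)[OF Q]] D_diff A_diff)
  moreover have "y = 0" if y: "y \<in> D" "P (y - Q y) = y" for y
  proof (rule ccontr)
    assume "y \<noteq> 0"
    have "P y = y" using y(2) proj_idem[OF P', of "y - Q y"] by simp
    moreover have "Q y = 0"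
    proof -
      have "Q y = Q (P (y - Q y))" using y(2) by simp
      also have "\<dots> = P (Q (y - Q y))" by (simp add: comm)
      also have "Q (y - Q y) = 0" by (simp add: proj_diff[OF Q'] proj_idem[OF Q'])
      finally show ?thesis by (simp add: proj_0[OF P'])
    qed
    ultimately have "m * (norm y)\<^sup>2 < l * (norm y)\<^sup>2"
      using splitsD(3)[OF P y(1)] splitsD(4)[OF Q y(1) _ \<open>y \<noteq> 0\<close>] by simp
    then show False using mult_right_mono[OF \<open>l \<le> m\<close>, of "(norm y)\<^sup>2"] by simp
  qed
  ultimately have "P (x - Q x) = 0" by (rule reducing_projection_zero)
  then show ?thesis by (simp add: proj_diff[OF P'] comm)
qed

section \<open>The spectral family of a self-adjoint operator\<close>

definition E :: "real \<Rightarrow> 'h \<Rightarrow> 'h" where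
  "E l = (SOME Q. splits l Q \<and> (\<forall>P. projection P \<longrightarrow> reduces P \<longrightarrow> (\<forall>x. P (Q x) = Q (P x))))"

lemma E_splits: "splits l (E l)"
  and E_commutes: "projection P \<Longrightarrow> reduces P \<Longrightarrow> P (E l x) = E l (P x)"
  using someI_ex[OF splits_exists[of l]] unfolding E_def[symmetric] by blast+

lemmas E_projection = splitsD(1)[OF E_splits] and E_reduces = splitsD(2)[OF E_splits]
  and E_upper = splitsD(3)[OF E_splits] and E_lower = splitsD(4)[OF E_splits]

text \<open>A splitting projection reduces \<open>A\<close>, hence commutes with \<open>E l\<close>,
  and \<open>splits_mono\<close> at equal levels applies in both directions.\<close>

lemma splits_unique:
  assumes P: "splits l P"
  shows "P = E l"
proof
  fix x
  have c: "P (E l x) = E l (P x)" for x using E_commutes splitsD(1,2)[OF P] by blast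
  have "E l (P x) = P x" using splits_mono[OF order_refl P E_splits c] .
  moreover have "P (E l x) = E l x" using splits_mono[OF order_refl E_splits P c[symmetric]] .
  ultimately show "P x = E l x" using c[of x] by simp
qed

lemma E_mono:
  assumes "l \<le> m"
  shows "E m (E l x) = E l x" "E l (E m x) = E l x"
proof -
  have c: "E l (E m x) = E m (E l x)" for x by (rule E_commutes[OF E_projection E_reduces])
  show "E m (E l x) = E l x" using splits_mono[OF assms E_splits E_splits c] .
  then show "E l (E m x) = E l x" using c by simp
qed

lemma E_norm_diff:
  assumes "l \<le> m"
  shows "(norm (E m x - E l x))\<^sup>2 = (norm (E m x))\<^sup>2 - (norm (E l x))\<^sup>2"
  using proj_norm_compl[OF E_projection, of "E m x" l] E_mono(2)[OF assms] by simp

text \<open>Along a decreasing sequence \<open>s\<close> the projections converge. The difference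
  \<open>z\<close> between the limit and \<open>E l x\<close> is fixed by every
  \<open>E (s m)\<close> and killed by \<open>E l\<close>, so
  \<open>\<langle>A z, z\<rangle> \<le> l * (norm z)\<^sup>2\<close>, with the strict reverse unless
  \<open>z = 0\<close>.\<close>

lemma E_right_continuous: "((\<lambda>m. E m x) \<longlongrightarrow> E l x) (at_right l)"
proof (rule projections_tendsto_dense[OF E_projection E_projection D_dense])
  fix x assume x: "x \<in> D"
  show "((\<lambda>m. E m x) \<longlongrightarrow> E l x) (at_right l)"
  proof (rule tendsto_at_right_sequentially[of l "l + 1"])
    fix s :: "nat \<Rightarrow> real"
    assume s: "\<And>n. l < s n" "decseq s" "s \<longlonglongrightarrow> l"
    have conv: "convergent (\<lambda>n. E (s n) y)" for y
    proof (rule monotone_norm_convergent)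
      have le: "(norm (E (s n) y))\<^sup>2 \<le> (norm (E (s m) y))\<^sup>2" if "m \<le> n" for m n
        using E_norm_diff[OF decseqD[OF s(2) that], of y] zero_le_power2[of "norm (E (s m) y - E (s n) y)"]
        by linarith
      then show "monoseq (\<lambda>n. (norm (E (s n) y))\<^sup>2)" by (intro decseq_imp_monoseq) (simp add: decseq_def)
      show "norm (E (s n) y) \<le> norm y" for n by (rule proj_norm_le[OF E_projection])
      show "(norm (E (s m) y - E (s n) y))\<^sup>2 = \<bar>(norm (E (s m) y))\<^sup>2 - (norm (E (s n) y))\<^sup>2\<bar>" for m n
      proof (cases "m \<le> n")
        case True
        then show ?thesis using E_norm_diff[OF decseqD[OF s(2) True], of y] le[OF True] by simp
      next
        case False
        then have "n \<le> m" by simp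
        then show ?thesis
          using E_norm_diff[OF decseqD[OF s(2) \<open>n \<le> m\<close>], of y] le[OF \<open>n \<le> m\<close>]
          by (simp add: norm_minus_commute)
      qed
    qed
    obtain y where y: "(\<lambda>n. E (s n) x) \<longlonglongrightarrow> y" using conv by (auto simp: convergent_def)
    \<comment> \<open>The images under \<open>A\<close> converge too, since \<open>E (s n)\<close>
      commutes with \<open>A\<close>; closedness then puts \<open>y\<close> into \<open>D\<close>,
      where the form inequalities apply.\<close>
    obtain w where w: "(\<lambda>n. E (s n) (A x)) \<longlonglongrightarrow> w" using conv by (auto simp: convergent_def)
    have "y \<in> D"
    proof (rule closed_graph(1)[OF _ y])
      show "E (s n) x \<in> D" for n by (rule reducesD(1)[OF E_reduces x])
      show "(\<lambda>n. A (E (s n) x)) \<longlonglongrightarrow> w" using w by (simp add: reducesD(2)[OF E_reduces x])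
    qed
    define z where "z = y - E l x"
    have z: "z \<in> D" using \<open>y \<in> D\<close> reducesD(1)[OF E_reduces x] by (simp add: z_def D_diff)
    have "(\<lambda>n. E l (E (s n) x)) \<longlonglongrightarrow> E l y" by (rule proj_tendsto[OF E_projection y])
    then have "E l y = E l x"
      using E_mono(2)[OF less_imp_le[OF s(1)]] by (simp add: LIMSEQ_const_iff)
    then have z0: "E l z = 0" by (simp add: z_def proj_diff[OF E_projection] proj_idem[OF E_projection])
    have zm: "E (s m) z = z" for m
    proof -
      have "\<forall>\<^sub>F n in sequentially. E (s n) x = E (s m) (E (s n) x)"
        using eventually_ge_at_top[of m] by eventually_elim (simp add: E_mono(1)[OF decseqD[OF s(2)]])
      with y have "(\<lambda>n. E (s m) (E (s n) x)) \<longlonglongrightarrow> y" by (rule Lim_transform_eventually)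
      then have "E (s m) y = y" by (rule LIMSEQ_unique[OF proj_tendsto[OF E_projection y]])
      then show ?thesis
        using E_mono(1)[OF less_imp_le[OF s(1)]] by (simp add: z_def proj_diff[OF E_projection])
    qed
    have "(\<lambda>n. s n * (norm z)\<^sup>2) \<longlonglongrightarrow> l * (norm z)\<^sup>2" by (intro tendsto_intros s)
    then have "\<langle>A z, z\<rangle> \<le> l * (norm z)\<^sup>2"
      using E_upper[OF z zm] by (intro LIMSEQ_le_const) auto
    then have "z = 0" using E_lower[OF z z0] by force
    then show "(\<lambda>n. E (s n) x) \<longlonglongrightarrow> E l x" using y by (simp add: z_def)
  qed simp
qed

text \<open>On the kernel of \<open>E l\<close> the form exceeds \<open>l\<close> times the squared
  norm, so for \<open>x\<close> in \<open>D\<close> Cauchy-Schwarz yields the rate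
  \<open>norm (A x) / l\<close>.\<close>

lemma E_at_top: "((\<lambda>l. E l x) \<longlongrightarrow> x) at_top"
proof (rule projections_tendsto_dense[OF E_projection projection_id D_dense])
  fix x assume x: "x \<in> D"
  have bound: "norm (x - E l x) \<le> norm (A x) / l" if "0 < l" for l
  proof (cases "x - E l x = 0")
    case True
    then show ?thesis using that by simp
  next
    case False
    define z where "z = x - E l x"
    have z: "z \<in> D" "A z = A x - E l (A x)"
      using x reducesD[OF E_reduces x] by (simp_all add: z_def D_diff A_diff)
    have "E l z = 0" by (simp add: z_def proj_diff[OF E_projection] proj_idem[OF E_projection])
    then have "l * (norm z)\<^sup>2 < \<langle>A z, z\<rangle>" using E_lower[OF z(1)] False by (simp add: z_def)
    also have "\<dots> \<le> norm (A z) * norm z" using cauchy_schwarz[of "A z" z] by simp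
    also have "\<dots> \<le> norm (A x) * norm z"
      using proj_norm_le[OF projection_compl[OF E_projection]] by (intro mult_right_mono) (simp_all add: z)
    finally have "l * norm z < norm (A x)" using False by (simp add: power2_eq_square z_def)
    then show ?thesis using that by (simp add: z_def field_simps)
  qed
  have lim: "((\<lambda>l. norm (A x) / l) \<longlongrightarrow> 0) at_top" 
    by (rule real_tendsto_divide_at_top[OF tendsto_const filterlim_ident])
  have "\<forall>\<^sub>F l in at_top. norm (x - E l x) \<le> norm (A x) / l"
    using eventually_gt_at_top[of 0] by eventually_elim (rule bound)
  then have "((\<lambda>l. x - E l x) \<longlongrightarrow> 0) at_top" using lim by (rule Lim_null_comparison)
  from tendsto_diff[OF tendsto_const this, of x] show "((\<lambda>l. E l x) \<longlongrightarrow> x) at_top" by simp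
qed

lemma E_at_bot: "((\<lambda>l. E l x) \<longlongrightarrow> 0) at_bot"
proof (rule projections_tendsto_dense[OF E_projection projection_zero D_dense])
  fix x assume x: "x \<in> D"
  have bound: "norm (E l x) \<le> norm (A x) / (- l)" if "l < 0" for l
  proof (cases "E l x = 0")
    case True
    then show ?thesis using that by (simp add: divide_nonneg_neg)
  next
    case False
    define z where "z = E l x"
    have z: "z \<in> D" "A z = E l (A x)" using reducesD[OF E_reduces x] by (simp_all add: z_def)
    have "\<langle>A z, z\<rangle> \<le> l * (norm z)\<^sup>2" using E_upper[OF z(1)] by (simp add: z_def proj_idem[OF E_projection])
    then have "- l * (norm z)\<^sup>2 \<le> - \<langle>A z, z\<rangle>" by simp
    also have "\<dots> \<le> norm (A z) * norm z" using cauchy_schwarz[of "A z" z] by simp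
    also have "\<dots> \<le> norm (A x) * norm z"
      using proj_norm_le[OF E_projection] by (intro mult_right_mono) (simp_all add: z)
    finally have "(- l * norm z) * norm z \<le> norm (A x) * norm z" by (simp add: power2_eq_square mult.assoc)
    then have "- l * norm z \<le> norm (A x)"
      by (rule mult_right_le_imp_le) (use False in \<open>simp add: z_def\<close>)
    then show ?thesis using that by (simp add: z_def field_simps)
  qed
  have lim: "((\<lambda>l. norm (A x) / (- l)) \<longlongrightarrow> 0) at_bot"
    by (rule real_tendsto_divide_at_top[OF tendsto_const filterlim_uminus_at_top_at_bot])
  have "\<forall>\<^sub>F l in at_bot. norm (E l x) \<le> norm (A x) / (- l)"
    using eventually_gt_at_bot[of 0] by eventually_elim (rule bound)
  then show "((\<lambda>l. E l x) \<longlongrightarrow> 0) at_bot" using lim by (rule Lim_null_comparison)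
qed

end

section \<open>Spectral measures\<close>

text \<open>Local estimates of the increments of \<open>G\<close> are glued together by bisection.\<close>

lemma stieltjes_integral_eqI:
  fixes F G \<phi> :: "real \<Rightarrow> real"
  assumes mono: "\<And>x y. x \<le> y \<Longrightarrow> F x \<le> F y" and rc: "\<And>a. continuous (at_right a) F"
    and \<phi>: "continuous_on UNIV \<phi>" and "a \<le> b"
    and local: "\<And>x e. a \<le> x \<Longrightarrow> x \<le> b \<Longrightarrow> 0 < e \<Longrightarrow>
      \<exists>d>0. \<forall>s t. a \<le> s \<longrightarrow> s \<le> x \<longrightarrow> x \<le> t \<longrightarrow> t \<le> b \<longrightarrow> t - s < d \<longrightarrow>
        \<bar>G t - G s - \<phi> x * (F t - F s)\<bar> \<le> e * (F t - F s)"
  shows "(LINT l:{a<..b}|interval_measure F. \<phi> l) = G b - G a"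
proof -
  let ?M = "interval_measure F"
  have em: "emeasure ?M {s<..t} < \<infinity>" if "s \<le> t" for s t
    by (simp add: emeasure_interval_measure_Ioc[OF that mono rc])
  have me: "measure ?M {s<..t} = F t - F s" if "s \<le> t" for s t
    by (rule measure_interval_measure_Ioc[OF that mono rc])
  have int: "set_integrable ?M {s<..t} \<phi>" if "s \<le> t" for s t
  proof -
    have "compact (\<phi> ` {s..t})"
      by (intro compact_continuous_image continuous_on_subset[OF \<phi>]) auto
    then obtain B where B: "\<And>l. l \<in> {s..t} \<Longrightarrow> norm (\<phi> l) \<le> B"
      using compact_imp_bounded bounded_iff by (metis imageI)
    have "\<phi> \<in> borel_measurable ?M"
      using borel_measurable_continuous_onI[OF \<phi>] by (simp cong: measurable_cong_sets)
    then show ?thesis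
      unfolding set_integrable_def
      by (intro integrableI_bounded_set_indicator[where B = B]) (use B em that in auto)
  qed
  have const: "set_integrable ?M {s<..t} (\<lambda>_. c)" "(LINT l:{s<..t}|?M. c) = c * (F t - F s)"
    if "s \<le> t" for s t c
    using em[OF that] me[OF that] by (simp_all add: set_integrable_def set_integral_const)
  \<comment> \<open>The estimate survives joining adjacent intervals, so bisection needs it only for
    short intervals around a point; the guards keep these between \<open>a\<close> and
    \<open>b\<close>.\<close>
  define P where "P e s t \<longleftrightarrow> (a \<le> s \<longrightarrow> t \<le> b \<longrightarrow>
      \<bar>(LINT l:{s<..t}|?M. \<phi> l) - (G t - G s)\<bar> \<le> e * (F t - F s))" for e s t
  have "P e a b" if e: "0 < e" for e
    using \<open>a \<le> b\<close>
  proof (induction a b rule: Bolzano)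
    case (trans s t u)
    have "(LINT l:{s<..u}|?M. \<phi> l) = (LINT l:{s<..t}|?M. \<phi> l) + (LINT l:{t<..u}|?M. \<phi> l)"
    proof -
      have "{s<..u} = {s<..t} \<union> {t<..u}" using trans by auto
      then show ?thesis using int trans by (simp add: set_integral_Un)
    qed
    then show ?case using trans unfolding P_def by (auto simp: algebra_simps)
  next
    case (local x)
    \<comment> \<open>Half of \<open>e\<close> pays for the local estimate of \<open>G\<close>, the
      other half for the oscillation of \<open>\<phi>\<close>.\<close>
    obtain d where d: "0 < d" "\<And>s t. a \<le> s \<Longrightarrow> s \<le> x \<Longrightarrow> x \<le> t \<Longrightarrow> t \<le> b \<Longrightarrow> t - s < d \<Longrightarrow>
        \<bar>G t - G s - \<phi> x * (F t - F s)\<bar> \<le> (e / 2) * (F t - F s)"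
      using assms(5)[OF local, of "e / 2"] e by auto
    obtain d' where d': "0 < d'" "\<And>l. dist l x < d' \<Longrightarrow> dist (\<phi> l) (\<phi> x) < e / 2"
      using \<phi> e unfolding continuous_on_iff by (metis UNIV_I half_gt_zero)
    have "P e s t" if st: "s \<le> x" "x \<le> t" "t - s < min d d'" for s t
      unfolding P_def
    proof (intro impI)
      assume r: "a \<le> s" "t \<le> b"
      have "s \<le> t" using st by simp
      have bd: "\<phi> x - e / 2 \<le> \<phi> l" "\<phi> l \<le> \<phi> x + e / 2" if "l \<in> {s<..t}" for l
      proof -
        have "dist l x < d'" using that st by (auto simp: dist_real_def)
        from d'(2)[OF this] show "\<phi> x - e / 2 \<le> \<phi> l" "\<phi> l \<le> \<phi> x + e / 2"
          unfolding dist_real_def by linarith+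
      qed
      have "(LINT l:{s<..t}|?M. \<phi> l) \<le> (LINT l:{s<..t}|?M. \<phi> x + e / 2)"
        using bd(2) by (intro set_integral_mono int const(1) \<open>s \<le> t\<close>)
      moreover have "(LINT l:{s<..t}|?M. \<phi> x - e / 2) \<le> (LINT l:{s<..t}|?M. \<phi> l)"
        using bd(1) by (intro set_integral_mono int const(1) \<open>s \<le> t\<close>)
      moreover have "\<bar>G t - G s - \<phi> x * (F t - F s)\<bar> \<le> (e / 2) * (F t - F s)"
        using d(2)[OF r(1) st(1,2) r(2)] st(3) by simp
      ultimately show "\<bar>(LINT l:{s<..t}|?M. \<phi> l) - (G t - G s)\<bar> \<le> e * (F t - F s)"
        unfolding const(2)[OF \<open>s \<le> t\<close>] distrib_right left_diff_distrib[of "\<phi> x"] by linarith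
    qed
    then show ?case using d(1) d'(1) by (intro exI[of _ "min d d'"]) simp
  qed
  then have le: "\<bar>(LINT l:{a<..b}|?M. \<phi> l) - (G b - G a)\<bar> \<le> e * (F b - F a)" if "0 < e" for e
    using that by (simp add: P_def)
  have "\<bar>(LINT l:{a<..b}|?M. \<phi> l) - (G b - G a)\<bar> \<le> 0"
  proof (rule field_le_epsilon)
    fix e :: real assume e: "0 < e"
    have "0 \<le> F b - F a" using mono[OF \<open>a \<le> b\<close>] by simp
    \<comment> \<open>The summand 1 keeps the denominator positive when \<open>F\<close> takes equal
      values at both ends.\<close>
    then have "0 < e / (F b - F a + 1)" "e / (F b - F a + 1) * (F b - F a) \<le> e"
      using e by (simp_all add: field_simps)
    then show "\<bar>(LINT l:{a<..b}|?M. \<phi> l) - (G b - G a)\<bar> \<le> 0 + e"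
      using le[of "e / (F b - F a + 1)"] by linarith
  qed
  then show ?thesis by simp
qed

text \<open>The order enters as two absorption equations, which \<open>projection_le\<close> derives
  from the order of quadratic forms.\<close>

locale real_spectral_family = real_hilbert ip
  for ip :: "'h::banach \<Rightarrow> 'h \<Rightarrow> real" (\<open>\<langle>_, _\<rangle>\<close>) +
  fixes E :: "real \<Rightarrow> 'h \<Rightarrow> 'h"
  assumes proj: "projection (E l)"
    and mono_left: "l \<le> m \<Longrightarrow> E m (E l x) = E l x"
    and mono_right: "l \<le> m \<Longrightarrow> E l (E m x) = E l x"
    and right_continuous: "((\<lambda>m. E m x) \<longlongrightarrow> E l x) (at_right l)"
    and at_bot: "((\<lambda>l. E l x) \<longlongrightarrow> 0) at_bot"
    and at_top: "((\<lambda>l. E l x) \<longlongrightarrow> x) at_top"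
begin

definition M :: "'h \<Rightarrow> real measure" where
  "M x = interval_measure (\<lambda>l. \<langle>E l x, x\<rangle>)"

lemma M_sets [simp, measurable_cong]: "sets (M x) = sets borel" and M_space [simp]: "space (M x) = UNIV"
  by (simp_all add: M_def)

lemma norm_increment: "l \<le> m \<Longrightarrow> (norm (E m x - E l x))\<^sup>2 = \<langle>E m x, x\<rangle> - \<langle>E l x, x\<rangle>"
  using proj_norm_compl[OF proj, of "E m x" l] mono_right[of l m x] by (simp add: proj_self[OF proj])

lemma distribution_mono: "l \<le> m \<Longrightarrow> \<langle>E l x, x\<rangle> \<le> \<langle>E m x, x\<rangle>"
  using norm_increment[of l m x] zero_le_power2[of "norm (E m x - E l x)"] by linarith

lemma distribution_right_continuous: "continuous (at_right l) (\<lambda>m. \<langle>E m x, x\<rangle>)"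
  unfolding continuous_within by (intro tendsto tendsto_const right_continuous)

lemma distribution_at_bot: "((\<lambda>l. \<langle>E l x, x\<rangle>) \<longlongrightarrow> 0) at_bot"
  using tendsto[OF at_bot[of x] tendsto_const[of x]] by (simp add: zero_left)

lemma distribution_at_top: "((\<lambda>l. \<langle>E l x, x\<rangle>) \<longlongrightarrow> (norm x)\<^sup>2) at_top"
  using tendsto[OF at_top[of x] tendsto_const[of x]] by (simp add: self)

lemma M_UNIV: "emeasure (M x) UNIV = ennreal ((norm x)\<^sup>2)"
  and M_finite_borel: "finite_borel_measure (M x)"
  unfolding M_def
  using interval_measure_UNIV[OF distribution_mono distribution_right_continuous
      distribution_at_bot distribution_at_top]
    finite_borel_measure_interval_measure[OF distribution_mono distribution_right_continuous
      distribution_at_bot distribution_at_top]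
  by simp_all

lemma M_finite: "finite_measure (M x)"
  using M_finite_borel finite_borel_measure_def by blast

lemma M_cdf: "cdf (M x) l = \<langle>E l x, x\<rangle>"
  unfolding M_def
  by (simp add: cdf_interval_measure[OF distribution_mono distribution_right_continuous distribution_at_bot])

lemma finite_borel_density: "S \<in> sets borel \<Longrightarrow> finite_borel_measure (density (M x) (indicator S))"
proof -
  assume S: "S \<in> sets borel"
  interpret finite_measure "M x" by (rule M_finite)
  have "finite_measure (density (M x) (indicator S))"
    by (rule finite_measureI) (use S in \<open>simp add: emeasure_restricted\<close>)
  then show ?thesis
    by (intro finite_borel_measure.intro finite_borel_measure_axioms.intro) simp_all
qed

text \<open>Both distribution functions at \<open>m\<close> equal
  \<open>\<langle>E (min l m) x, x\<rangle>\<close>, and they determine finite measures. With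
  \<open>M_above\<close> this lets the uniqueness proof restrict vectors by restricting
  measures.\<close>

lemma M_below: "M (E l x) = density (M x) (indicator {..l})"
proof (rule cdf_unique'[OF M_finite_borel finite_borel_density])
  show "cdf (M (E l x)) = cdf (density (M x) (indicator {..l}))"
  proof
    fix m
    have "cdf (density (M x) (indicator {..l})) m = measure (M x) ({..l} \<inter> {..m})"
      by (simp add: cdf_def measure_restricted)
    also have "{..l} \<inter> {..m} = {..min l m}" by auto
    also have "measure (M x) {..min l m} = \<langle>E (min l m) x, x\<rangle>" using M_cdf by (simp add: cdf_def)
    also have "\<dots> = \<langle>E m (E l x), E l x\<rangle>"
      using mono_left[of l m x] mono_right[of m l x] proj_self[OF proj, of l x]
        proj_sym[OF proj, of m x "E l x"] proj_sym[OF proj, of l x "E m x"] commute[of "E m x" "E l x"]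
      by (cases "l \<le> m") (auto simp: min_def self commute)
    finally show "cdf (M (E l x)) m = cdf (density (M x) (indicator {..l})) m" by (simp add: M_cdf)
  qed
qed simp

lemma M_above: "M (x - E l x) = density (M x) (indicator {l<..})"
proof (rule cdf_unique'[OF M_finite_borel finite_borel_density])
  show "cdf (M (x - E l x)) = cdf (density (M x) (indicator {l<..}))"
  proof
    fix m
    have d: "cdf (density (M x) (indicator {l<..})) m = measure (M x) ({l<..} \<inter> {..m})"
      by (simp add: cdf_def measure_restricted)
    show "cdf (M (x - E l x)) m = cdf (density (M x) (indicator {l<..})) m"
    proof (cases "l \<le> m")
      case True
      have "{l<..} \<inter> {..m} = {l<..m}" by auto
      moreover have "measure (M x) {l<..m} = \<langle>E m x, x\<rangle> - \<langle>E l x, x\<rangle>"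
        unfolding M_def
        by (rule measure_interval_measure_Ioc[OF True distribution_mono distribution_right_continuous])
      moreover have "\<langle>E m (x - E l x), x - E l x\<rangle> = (norm (E m x - E l x))\<^sup>2"
        unfolding proj_self[OF proj] using mono_left[OF True, of x] by (simp add: proj_diff[OF proj])
      ultimately show ?thesis by (simp add: d M_cdf norm_increment[OF True])
    next
      case False
      then have "{l<..} \<inter> {..m} = {}" by auto
      moreover have "E m (x - E l x) = 0"
        using False mono_right[of m l x] by (simp add: proj_diff[OF proj])
      ultimately show ?thesis by (simp add: d M_cdf zero_left)
    qed
  qed
qed simp

end

section \<open>Spectral projections of bounded intervals\<close>

context real_self_adjoint
begin

sublocale S: real_spectral_family ip E
  by unfold_locales
    (fact E_projection E_mono E_right_continuous E_at_bot E_at_top)+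

text \<open>The spectral projection of the half-open interval \<open>{a<..b}\<close>, the kind of
  interval to which \<open>interval_measure\<close> assigns an increment.\<close>

definition P :: "real \<Rightarrow> real \<Rightarrow> 'h \<Rightarrow> 'h" where "P a b x = E b x - E a x"

lemma P_projection: "a \<le> b \<Longrightarrow> projection (P a b)"
  using projection_comp[OF E_projection[of b] projection_compl[OF E_projection[of a]]] E_mono
  unfolding P_def by (simp add: proj_diff[OF E_projection])

lemma P_reduces: "reduces (P a b)"
  unfolding reduces_def P_def by (simp add: reducesD[OF E_reduces] D_diff A_diff)

lemma P_fixed_iff:
  assumes "a \<le> b"
  shows "P a b x = x \<longleftrightarrow> E b x = x \<and> E a x = 0"
proof
  assume *: "P a b x = x"
  have "E b (P a b x) = P a b x" "E a (P a b x) = 0"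
    using E_mono[OF assms] by (simp_all add: P_def proj_diff[OF E_projection] proj_idem[OF E_projection])
  then show "E b x = x \<and> E a x = 0" by (simp add: *)
qed (simp add: P_def)

text \<open>On the range of \<open>P a b\<close> the form of \<open>A - c\<close> lies between
  \<open>a - c\<close> and \<open>b - c\<close>, and for a symmetric operator a form bound is a norm
  bound.\<close>

lemma P_sandwich:
  assumes c: "a \<le> c" "c \<le> b" and z: "z \<in> D" "P a b z = z"
  shows "norm (A z - c *\<^sub>R z) \<le> (b - a) * norm z"
proof -
  have ab: "a \<le> b" using c by simp
  note Pab = P_projection[OF ab]
  define V where "V = {v \<in> D. P a b v = v}"
  define T where "T = (\<lambda>v. A v - c *\<^sub>R v)"
  have V: "subspace V"
    unfolding V_def subspace_def
    using D_0 D_add D_scale by (auto simp: proj_0[OF Pab] proj_add[OF Pab] proj_scale[OF Pab])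
  have form: "\<bar>\<langle>T v, v\<rangle>\<bar> \<le> (b - a) * (norm v)\<^sup>2" if "v \<in> V" for v
  proof -
    have v: "v \<in> D" "E b v = v" "E a v = 0" using that P_fixed_iff[OF ab] by (auto simp: V_def)
    have "a * (norm v)\<^sup>2 \<le> \<langle>A v, v\<rangle>"
      using E_lower[OF v(1,3)] A_0 by (cases "v = 0") (auto simp: zero_left)
    moreover have "\<langle>A v, v\<rangle> \<le> b * (norm v)\<^sup>2" using E_upper[OF v(1,2)] .
    moreover have "a * (norm v)\<^sup>2 \<le> c * (norm v)\<^sup>2" "c * (norm v)\<^sup>2 \<le> b * (norm v)\<^sup>2"
      using c by (simp_all add: mult_right_mono)
    ultimately show ?thesis by (simp add: T_def bilin self left_diff_distrib abs_le_iff)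
  qed
  have bound: "\<langle>T z, w\<rangle> \<le> (b - a) * norm z * norm w" if w: "w \<in> D" for w
  proof -
    \<comment> \<open>\<open>T z\<close> lies in the range of \<open>P a b\<close>, so it pairs with
      \<open>w\<close> only through \<open>P a b w\<close>; the bound on \<open>V\<close> thus
      extends to all of \<open>D\<close>.\<close>
    have "P a b w \<in> V" using w P_reduces by (simp add: V_def reducesD proj_idem[OF Pab])
    then have "\<langle>T z, P a b w\<rangle> \<le> (b - a) * norm z * norm (P a b w)"
      using z by (intro bound_of_form_bound[OF V _ _ _ form])
        (auto simp: V_def T_def A_add A_scale A_sym bilin algebra_simps)
    also have "\<dots> \<le> (b - a) * norm z * norm w"
      using ab proj_norm_le[OF Pab] by (intro mult_left_mono) auto
    also have "\<langle>T z, P a b w\<rangle> = \<langle>T z, w\<rangle>"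
      using reducesD(2)[OF P_reduces z(1), of a b] z(2)
      by (simp add: T_def proj_sym[OF Pab, symmetric] proj_diff[OF Pab] proj_scale[OF Pab])
    finally show ?thesis .
  qed
  \<comment> \<open>\<open>T z\<close> is not yet known to lie in \<open>D\<close>, so the choice
    \<open>w = T z\<close> is reached by density.\<close>
  have "closed {w. \<langle>T z, w\<rangle> \<le> (b - a) * norm z * norm w}"
    by (intro closed_Collect_le continuous_intros continuous_on)
  then have "closure D \<subseteq> {w. \<langle>T z, w\<rangle> \<le> (b - a) * norm z * norm w}"
    using bound by (intro closure_minimal) auto
  then have "\<langle>T z, T z\<rangle> \<le> (b - a) * norm z * norm (T z)" using D_dense by blast
  then have "norm (T z) * norm (T z) \<le> (b - a) * norm z * norm (T z)" by (simp add: self power2_eq_square)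
  then have "norm (T z) \<le> (b - a) * norm z"
    using ab by (cases "T z = 0") auto
  then show ?thesis by (simp add: T_def)
qed

text \<open>By \<open>P_sandwich\<close>, \<open>A - a\<close> is Lipschitz on the vectors of
  \<open>D\<close> fixed by \<open>P a b\<close>; images of an approximating sequence converge, and
  the closed graph does the rest.\<close>

lemma P_in_D:
  assumes ab: "a \<le> b"
  shows "P a b x \<in> D"
proof -
  note Pab = P_projection[OF ab]
  have "x \<in> closure D" using D_dense by simp
  then obtain d where d: "\<And>n. d n \<in> D" "d \<longlonglongrightarrow> x" by (auto simp: closure_sequential)
  define z where "z = (\<lambda>n. P a b (d n))"
  have z: "z n \<in> D" "P a b (z n) = z n" for n
    using d(1) by (simp_all add: z_def reducesD[OF P_reduces] proj_idem[OF Pab])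
  have zlim: "z \<longlonglongrightarrow> P a b x" unfolding z_def by (rule proj_tendsto[OF Pab d(2)])
  have lip: "norm ((A (z m) - a *\<^sub>R z m) - (A (z n) - a *\<^sub>R z n)) \<le> (b - a) * norm (z m - z n)" for m n
  proof -
    have "norm (A (z m - z n) - a *\<^sub>R (z m - z n)) \<le> (b - a) * norm (z m - z n)"
      using z ab by (intro P_sandwich) (simp_all add: D_diff proj_diff[OF Pab])
    then show ?thesis using z by (simp add: A_diff algebra_simps)
  qed
  have "Cauchy (\<lambda>n. A (z n) - a *\<^sub>R z n)"
  proof (rule metric_CauchyI)
    fix e :: real assume e: "0 < e"
    have "Cauchy z" using zlim by (rule LIMSEQ_imp_Cauchy)
    then obtain N where N: "\<forall>m\<ge>N. \<forall>n\<ge>N. dist (z m) (z n) < e / (b - a + 1)"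
      using metric_CauchyD[of z "e / (b - a + 1)"] e ab by auto
    have "dist (A (z m) - a *\<^sub>R z m) (A (z n) - a *\<^sub>R z n) < e" if "m \<ge> N" "n \<ge> N" for m n
    proof -
      have "norm (z m - z n) < e / (b - a + 1)" using N that by (simp add: dist_norm)
      then have "norm (z m - z n) * (b - a + 1) < e" using ab by (simp add: pos_less_divide_eq)
      then have "(b - a) * norm (z m - z n) + norm (z m - z n) < e" by (simp add: algebra_simps)
      then show ?thesis using lip[of m n] norm_ge_zero[of "z m - z n"] unfolding dist_norm by linarith
    qed
    then show "\<exists>N. \<forall>m\<ge>N. \<forall>n\<ge>N. dist (A (z m) - a *\<^sub>R z m) (A (z n) - a *\<^sub>R z n) < e" by blast
  qed
  then obtain y where "(\<lambda>n. A (z n) - a *\<^sub>R z n) \<longlonglongrightarrow> y" by (auto simp: Cauchy_convergent_iff convergent_def)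
  from tendsto_add[OF this tendsto_scaleR[OF tendsto_const zlim, of a]]
  have "(\<lambda>n. A (z n)) \<longlonglongrightarrow> y + a *\<^sub>R P a b x" by simp
  then show ?thesis using closed_graph(1)[OF z(1) zlim] by blast
qed

lemma spectral_integrals_Ioc:
  assumes ab: "a \<le> b"
  shows "(LINT l:{a<..b}|S.M x. l) = \<langle>A (P a b x), P a b x\<rangle>"
    and "(LINT l:{a<..b}|S.M x. l\<^sup>2) = (norm (A (P a b x)))\<^sup>2"
proof -
  define F where "F = (\<lambda>l. \<langle>E l x, x\<rangle>)"
  have P0: "P a a x = 0" by (simp add: P_def)
  \<comment> \<open>\<open>E s\<close> reduces \<open>A\<close>, fixes \<open>P a s x\<close> and
    kills \<open>P s t x\<close>, so the cross terms vanish and each increment depends on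
    \<open>P s t x\<close> alone.\<close>
  have incr: "\<langle>A (P a t x), P a t x\<rangle> - \<langle>A (P a s x), P a s x\<rangle> = \<langle>A (P s t x), P s t x\<rangle>"
       "(norm (A (P a t x)))\<^sup>2 - (norm (A (P a s x)))\<^sup>2 = (norm (A (P s t x)))\<^sup>2"
       "(norm (P s t x))\<^sup>2 = F t - F s"
       if st: "a \<le> s" "s \<le> t" for s t
  proof -
    define u z where "u = P a s x" and "z = P s t x"
    have uz: "P a t x = u + z" "u \<in> D" "z \<in> D"
      using st P_in_D by (simp_all add: P_def u_def z_def)
    have fixed: "E s u = u" "E s z = 0"
      using st E_mono by (simp_all add: P_def u_def z_def proj_diff[OF E_projection] proj_idem[OF E_projection])
    have "E s (A u) = A u" "E s (A z) = 0"
      using reducesD(2)[OF E_reduces uz(2), of s] reducesD(2)[OF E_reduces uz(3), of s] fixed A_0 by simp_all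
    then have "\<langle>A u, z\<rangle> = 0" "\<langle>A z, u\<rangle> = 0" "\<langle>A u, A z\<rangle> = 0"
      using fixed proj_sym[OF E_projection, of s "A u" z] proj_sym[OF E_projection, of s "A z" u]
        proj_sym[OF E_projection, of s "A u" "A z"] by (simp_all add: zero_left zero_right)
    then have "\<langle>A (u + z), u + z\<rangle> - \<langle>A u, u\<rangle> = \<langle>A z, z\<rangle>"
       "(norm (A (u + z)))\<^sup>2 - (norm (A u))\<^sup>2 = (norm (A z))\<^sup>2"
      using uz by (simp_all add: A_add bilin norm_add_sq)
    then show "\<langle>A (P a t x), P a t x\<rangle> - \<langle>A (P a s x), P a s x\<rangle> = \<langle>A (P s t x), P s t x\<rangle>"
       "(norm (A (P a t x)))\<^sup>2 - (norm (A (P a s x)))\<^sup>2 = (norm (A (P s t x)))\<^sup>2"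
      by (simp_all add: uz(1) flip: u_def z_def)
    show "(norm (P s t x))\<^sup>2 = F t - F s" using S.norm_increment[OF st(2)] by (simp add: P_def F_def)
  qed
  \<comment> \<open>Write \<open>A z = q + c *\<^sub>R z\<close> with
    \<open>norm q \<le> (t - s) * norm z\<close>: the errors relative to \<open>c\<close> and
    \<open>c\<^sup>2\<close> shrink with \<open>t - s\<close>, as
    \<open>stieltjes_integral_eqI\<close> demands.\<close>
  have near: "\<bar>\<langle>A z, z\<rangle> - c * (norm z)\<^sup>2\<bar> \<le> (t - s) * (norm z)\<^sup>2"
      "\<bar>(norm (A z))\<^sup>2 - c\<^sup>2 * (norm z)\<^sup>2\<bar> \<le> ((t - s) * (t - s + 2 * \<bar>c\<bar>)) * (norm z)\<^sup>2"
    if st: "s \<le> c" "c \<le> t" and z_def: "z = P s t x" for s t c z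
  proof -
    have st': "s \<le> t" using st by simp
    have n: "norm (A z - c *\<^sub>R z) \<le> (t - s) * norm z"
      using P_sandwich[OF st] P_in_D[OF st'] proj_idem[OF P_projection[OF st']] by (simp add: z_def)
    define q where "q = A z - c *\<^sub>R z"
    have Az: "A z = q + c *\<^sub>R z" by (simp add: q_def)
    have qz: "\<bar>\<langle>q, z\<rangle>\<bar> \<le> (t - s) * (norm z)\<^sup>2"
      using cauchy_schwarz[of q z] mult_right_mono[OF n norm_ge_zero[of z]]
      by (simp add: q_def power2_eq_square mult.assoc)
    then show "\<bar>\<langle>A z, z\<rangle> - c * (norm z)\<^sup>2\<bar> \<le> (t - s) * (norm z)\<^sup>2"
      by (simp add: Az bilin self)
    have "(norm (A z))\<^sup>2 - c\<^sup>2 * (norm z)\<^sup>2 = (norm q)\<^sup>2 + 2 * c * \<langle>q, z\<rangle>"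
      unfolding Az norm_add_sq by (simp add: scaleR_right power_mult_distrib)
    also have "\<bar>\<dots>\<bar> \<le> (norm q)\<^sup>2 + 2 * \<bar>c\<bar> * \<bar>\<langle>q, z\<rangle>\<bar>"
      using abs_triangle_ineq[of "(norm q)\<^sup>2" "2 * c * \<langle>q, z\<rangle>"] by (simp add: abs_mult)
    also have "\<dots> \<le> ((t - s) * norm z)\<^sup>2 + 2 * \<bar>c\<bar> * ((t - s) * (norm z)\<^sup>2)"
      using n qz by (intro add_mono power_mono mult_left_mono) (simp_all add: q_def)
    also have "\<dots> = ((t - s) * (t - s + 2 * \<bar>c\<bar>)) * (norm z)\<^sup>2"
      by (simp add: power2_eq_square algebra_simps)
    finally show "\<bar>(norm (A z))\<^sup>2 - c\<^sup>2 * (norm z)\<^sup>2\<bar> \<le> ((t - s) * (t - s + 2 * \<bar>c\<bar>)) * (norm z)\<^sup>2" .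
  qed
  have F_mono: "F s \<le> F t" if "s \<le> t" for s t unfolding F_def by (rule S.distribution_mono[OF that])
  have F_rc: "continuous (at_right l) F" for l unfolding F_def by (rule S.distribution_right_continuous)
  have "(LINT l:{a<..b}|interval_measure F. l) = \<langle>A (P a b x), P a b x\<rangle> - \<langle>A (P a a x), P a a x\<rangle>"
  proof (rule stieltjes_integral_eqI[OF F_mono F_rc _ ab])
    fix c e :: real assume c: "a \<le> c" "c \<le> b" and e: "0 < e"
    show "\<exists>d>0. \<forall>s t. a \<le> s \<longrightarrow> s \<le> c \<longrightarrow> c \<le> t \<longrightarrow> t \<le> b \<longrightarrow> t - s < d \<longrightarrow>
        \<bar>\<langle>A (P a t x), P a t x\<rangle> - \<langle>A (P a s x), P a s x\<rangle> - c * (F t - F s)\<bar> \<le> e * (F t - F s)"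
    proof (intro exI[of _ e] conjI e allI impI)
      fix s t assume st: "a \<le> s" "s \<le> c" "c \<le> t" "t - s < e"
      then have "s \<le> t" by simp
      have "\<bar>\<langle>A (P s t x), P s t x\<rangle> - c * (F t - F s)\<bar> \<le> (t - s) * (F t - F s)"
        using near(1)[OF st(2,3) refl] by (simp add: incr(3)[OF st(1) \<open>s \<le> t\<close>])
      also have "\<dots> \<le> e * (F t - F s)" using st(4) F_mono[OF \<open>s \<le> t\<close>] by (intro mult_right_mono) simp_all
      finally show "\<bar>\<langle>A (P a t x), P a t x\<rangle> - \<langle>A (P a s x), P a s x\<rangle> - c * (F t - F s)\<bar> \<le> e * (F t - F s)"
        by (simp add: incr(1)[OF st(1) \<open>s \<le> t\<close>])
    qed
  qed (simp_all add: continuous_on_id)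
  then show "(LINT l:{a<..b}|S.M x. l) = \<langle>A (P a b x), P a b x\<rangle>"
    by (simp add: S.M_def F_def P0 A_0 zero_left)
  have "(LINT l:{a<..b}|interval_measure F. l\<^sup>2) = (norm (A (P a b x)))\<^sup>2 - (norm (A (P a a x)))\<^sup>2"
  proof (rule stieltjes_integral_eqI[OF F_mono F_rc _ ab])
    fix c e :: real assume c: "a \<le> c" "c \<le> b" and e: "0 < e"
    \<comment> \<open>Chosen so that \<open>t - s < d\<close> gives \<open>(t - s) * (t - s + 2 *
      \<bar>c\<bar>) \<le> d * (1 + 2 * \<bar>c\<bar>) \<le> e\<close>.\<close>
    define d where "d = min 1 (e / (1 + 2 * \<bar>c\<bar>))"
    have c2: "0 < 1 + 2 * \<bar>c\<bar>" and "d \<le> e / (1 + 2 * \<bar>c\<bar>)" by (simp_all add: d_def)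
    then have "d * (1 + 2 * \<bar>c\<bar>) \<le> e" by (simp only: pos_le_divide_eq)
    moreover have "0 < d" "d \<le> 1" using e c2 by (simp_all add: d_def)
    ultimately have d: "0 < d" "d \<le> 1" "d * (1 + 2 * \<bar>c\<bar>) \<le> e" by blast+
    show "\<exists>d>0. \<forall>s t. a \<le> s \<longrightarrow> s \<le> c \<longrightarrow> c \<le> t \<longrightarrow> t \<le> b \<longrightarrow> t - s < d \<longrightarrow>
        \<bar>(norm (A (P a t x)))\<^sup>2 - (norm (A (P a s x)))\<^sup>2 - c\<^sup>2 * (F t - F s)\<bar> \<le> e * (F t - F s)"
    proof (intro exI[of _ d] conjI d allI impI)
      fix s t assume st: "a \<le> s" "s \<le> c" "c \<le> t" "t - s < d"
      then have "s \<le> t" by simp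
      have "\<bar>(norm (A (P s t x)))\<^sup>2 - c\<^sup>2 * (F t - F s)\<bar> \<le> ((t - s) * (t - s + 2 * \<bar>c\<bar>)) * (F t - F s)"
        using near(2)[OF st(2,3) refl] by (simp add: incr(3)[OF st(1) \<open>s \<le> t\<close>])
      also have "\<dots> \<le> e * (F t - F s)"
      proof (rule mult_right_mono)
        have "(t - s) * (t - s + 2 * \<bar>c\<bar>) \<le> d * (1 + 2 * \<bar>c\<bar>)"
          using st d \<open>s \<le> t\<close> by (intro mult_mono) auto
        then show "(t - s) * (t - s + 2 * \<bar>c\<bar>) \<le> e" using d(3) by simp
        show "0 \<le> F t - F s" using F_mono[OF \<open>s \<le> t\<close>] by simp
      qed
      finally show "\<bar>(norm (A (P a t x)))\<^sup>2 - (norm (A (P a s x)))\<^sup>2 - c\<^sup>2 * (F t - F s)\<bar> \<le> e * (F t - F s)"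
        by (simp add: incr(2)[OF st(1) \<open>s \<le> t\<close>])
    qed
  qed (auto intro: continuous_intros)
  then show "(LINT l:{a<..b}|S.M x. l\<^sup>2) = (norm (A (P a b x)))\<^sup>2"
    by (simp add: S.M_def F_def P0 A_0)
qed

section \<open>Truncations and moment formulas on the whole line\<close>

definition trunc :: "nat \<Rightarrow> 'h \<Rightarrow> 'h" where "trunc n = P (- real n) (real n)"

lemma trunc_projection: "projection (trunc n)"
  unfolding trunc_def by (rule P_projection) simp

lemma trunc_in_D: "trunc n x \<in> D"
  unfolding trunc_def by (rule P_in_D) simp

lemma trunc_A: "x \<in> D \<Longrightarrow> A (trunc n x) = trunc n (A x)"
  unfolding trunc_def by (rule reducesD(2)[OF P_reduces])

lemma trunc_trunc: "m \<le> n \<Longrightarrow> trunc m (trunc n x) = trunc m x"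
  by (simp add: trunc_def P_def proj_diff[OF E_projection] E_mono)

lemma trunc_tendsto: "(\<lambda>n. trunc n x) \<longlonglongrightarrow> x"
proof -
  have "(\<lambda>n. E (real n) x) \<longlonglongrightarrow> x"
    by (rule filterlim_compose[OF E_at_top filterlim_real_sequentially])
  moreover have "(\<lambda>n. E (- real n) x) \<longlonglongrightarrow> 0"
    by (rule filterlim_compose[OF E_at_bot filterlim_compose[OF filterlim_uminus_at_bot_at_top filterlim_real_sequentially]])
  ultimately have "(\<lambda>n. E (real n) x - E (- real n) x) \<longlonglongrightarrow> x - 0" by (rule tendsto_diff)
  then show ?thesis by (simp add: trunc_def P_def)
qed

text \<open>Holds for every \<open>x\<close>, with an infinite limit allowed: truncated vectors
  always lie in \<open>D\<close>, and the integrals over growing intervals increase to the full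
  moment. This is what allows finiteness to characterize \<open>D\<close>.\<close>

lemma spectral_second_moment:
  "(\<lambda>n. ennreal ((norm (A (trunc n x)))\<^sup>2)) \<longlonglongrightarrow> (\<integral>\<^sup>+l. ennreal (l\<^sup>2) \<partial>S.M x)"
proof -
  interpret finite_measure "S.M x" by (rule S.M_finite)
  define f where "f n l = ennreal (l\<^sup>2) * indicator {- real n<..real n} l" for n l
  have "(\<integral>\<^sup>+l. f n l \<partial>S.M x) = ennreal ((norm (A (trunc n x)))\<^sup>2)" for n
  proof -
    have "(\<integral>\<^sup>+l. f n l \<partial>S.M x) = (\<integral>\<^sup>+l. ennreal (indicator {- real n<..real n} l *\<^sub>R l\<^sup>2) \<partial>S.M x)"
      by (intro nn_integral_cong) (simp add: f_def indicator_def)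
    also have "\<dots> = ennreal (LINT l:{- real n<..real n}|S.M x. l\<^sup>2)"
      unfolding set_lebesgue_integral_def
    proof (rule nn_integral_eq_integral)
      have "norm (l\<^sup>2) \<le> (real n)\<^sup>2" if "l \<in> {- real n<..real n}" for l :: real
        using that by (auto intro!: abs_le_square_iff[THEN iffD1])
      then show "integrable (S.M x) (\<lambda>l. indicator {- real n<..real n} l *\<^sub>R l\<^sup>2)"
        by (intro integrableI_bounded_set_indicator[where B = "(real n)\<^sup>2"]) (auto simp: emeasure_eq_measure)
    qed simp
    finally show ?thesis by (simp add: spectral_integrals_Ioc(2) trunc_def)
  qed
  moreover have "(\<lambda>n. \<integral>\<^sup>+l. f n l \<partial>S.M x) \<longlonglongrightarrow> (\<integral>\<^sup>+l. ennreal (l\<^sup>2) \<partial>S.M x)"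
  proof (rule nn_integral_LIMSEQ)
    show "incseq f" by (auto simp: incseq_def le_fun_def f_def indicator_def)
    fix l :: real
    obtain N where N: "\<bar>l\<bar> < real N" using reals_Archimedean2 by blast
    have "\<forall>\<^sub>F n in sequentially. f n l = ennreal (l\<^sup>2)"
      using eventually_ge_at_top[of N]
    proof eventually_elim
      case (elim n)
      then have "l \<in> {- real n<..real n}" using N by auto
      then show ?case by (simp add: f_def)
    qed
    then show "(\<lambda>n. f n l) \<longlonglongrightarrow> ennreal (l\<^sup>2)" by (rule tendsto_eventually)
  qed (simp add: f_def)
  ultimately show ?thesis by simp
qed

text \<open>A finite moment bounds the norms of \<open>A (trunc n x)\<close>. These vectors are
  truncations of one another, so they converge, and closedness of \<open>A\<close> puts
  \<open>x\<close> into \<open>D\<close>.\<close>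

lemma domain_eq: "D = {x. (\<integral>\<^sup>+l. ennreal (l\<^sup>2) \<partial>S.M x) < \<infinity>}"
proof safe
  fix x assume x: "x \<in> D"
  have "ennreal ((norm (A (trunc n x)))\<^sup>2) \<le> ennreal ((norm (A x))\<^sup>2)" for n
    using proj_norm_le[OF trunc_projection] by (simp add: trunc_A[OF x] power_mono ennreal_leI)
  then have "(\<integral>\<^sup>+l. ennreal (l\<^sup>2) \<partial>S.M x) \<le> ennreal ((norm (A x))\<^sup>2)"
    using LIMSEQ_le_const2[OF spectral_second_moment] by blast
  then show "(\<integral>\<^sup>+l. ennreal (l\<^sup>2) \<partial>S.M x) < \<infinity>" using le_less_trans by fastforce
next
  fix x assume fin: "(\<integral>\<^sup>+l. ennreal (l\<^sup>2) \<partial>S.M x) < \<infinity>"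
  define X where "X n = A (trunc n x)" for n
  have XX: "trunc m (X n) = X m" if "m \<le> n" for m n
    by (simp add: X_def trunc_A[OF trunc_in_D, symmetric] trunc_trunc[OF that])
  have mono: "norm (X m) \<le> norm (X n)" if "m \<le> n" for m n
    using proj_norm_le[OF trunc_projection, of m "X n"] by (simp add: XX[OF that])
  have diff: "(norm (X n - X m))\<^sup>2 = \<bar>(norm (X n))\<^sup>2 - (norm (X m))\<^sup>2\<bar>" if "m \<le> n" for m n
    using proj_norm_compl[OF trunc_projection, of "X n" m] power_mono[OF mono[OF that], of 2]
    by (simp add: XX[OF that])
  obtain K where K: "0 \<le> K" "(\<integral>\<^sup>+l. ennreal (l\<^sup>2) \<partial>S.M x) = ennreal K"
    using fin by (metis ennreal_cases infinity_ennreal_def less_irrefl)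
  have "incseq (\<lambda>n. ennreal ((norm (X n))\<^sup>2))"
    using mono by (auto simp: incseq_def power_mono intro!: ennreal_leI)
  then have "ennreal ((norm (X n))\<^sup>2) \<le> ennreal K" for n
    using spectral_second_moment[of x] unfolding K(2) X_def by (rule incseq_le)
  then have "(norm (X n))\<^sup>2 \<le> K" for n using K(1) by simp
  then have bound: "norm (X n) \<le> sqrt K" for n by (rule real_le_rsqrt)
  have "convergent X"
  proof (rule monotone_norm_convergent[OF _ bound])
    show "monoseq (\<lambda>n. (norm (X n))\<^sup>2)"
      using mono by (intro incseq_imp_monoseq) (simp add: incseq_def power_mono)
    show "(norm (X m - X n))\<^sup>2 = \<bar>(norm (X m))\<^sup>2 - (norm (X n))\<^sup>2\<bar>" for m n
      using diff[of m n] diff[of n m] norm_minus_commute[of "X m" "X n"]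
      by (cases "m \<le> n") (simp_all add: abs_minus_commute)
  qed
  then obtain y where "X \<longlonglongrightarrow> y" by (auto simp: convergent_def)
  then show "x \<in> D"
    using closed_graph(1)[OF trunc_in_D trunc_tendsto] unfolding X_def by blast
qed

lemma second_moment_eq:
  assumes x: "x \<in> D"
  shows "(\<integral>\<^sup>+l. ennreal (l\<^sup>2) \<partial>S.M x) = ennreal ((norm (A x))\<^sup>2)"
proof -
  have "(\<lambda>n. ennreal ((norm (A (trunc n x)))\<^sup>2)) \<longlonglongrightarrow> ennreal ((norm (A x))\<^sup>2)"
    unfolding trunc_A[OF x] by (intro tendsto_ennrealI tendsto_intros trunc_tendsto)
  then show ?thesis using spectral_second_moment LIMSEQ_unique by blast
qed

lemma square_integral_eq:
  assumes x: "x \<in> D"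
  shows "integrable (S.M x) (\<lambda>l. l\<^sup>2)" "(\<integral>l. l\<^sup>2 \<partial>S.M x) = (norm (A x))\<^sup>2"
proof -
  show "integrable (S.M x) (\<lambda>l. l\<^sup>2)"
    by (rule integrableI_nonneg) (simp_all add: second_moment_eq[OF x])
  show "(\<integral>l. l\<^sup>2 \<partial>S.M x) = (norm (A x))\<^sup>2"
    by (rule integral_eq_nn_integral[THEN trans]) (simp_all add: second_moment_eq[OF x])
qed

lemma integral_eq:
  assumes x: "x \<in> D"
  shows "integrable (S.M x) (\<lambda>l. l)" "(\<integral>l. l \<partial>S.M x) = \<langle>A x, x\<rangle>"
proof -
  interpret finite_measure "S.M x" by (rule S.M_finite)
  show int: "integrable (S.M x) (\<lambda>l. l)"
  proof (rule Bochner_Integration.integrable_bound)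
    show "integrable (S.M x) (\<lambda>l. 1 + l\<^sup>2)" using square_integral_eq(1)[OF x] by simp
    show "AE l in S.M x. norm l \<le> norm (1 + l\<^sup>2)"
    proof (rule AE_I2)
      fix l :: real
      have "0 \<le> (\<bar>l\<bar> - 1)\<^sup>2" by simp
      then have "2 * \<bar>l\<bar> \<le> 1 + l\<^sup>2" by (simp add: power2_diff)
      then show "norm l \<le> norm (1 + l\<^sup>2)" by simp
    qed
  qed simp
  have "(\<lambda>n. LINT l:{- real n<..real n}|S.M x. l) \<longlonglongrightarrow> (\<integral>l. l \<partial>S.M x)"
    unfolding set_lebesgue_integral_def
  proof (rule integral_dominated_convergence[where w = "\<lambda>l. \<bar>l\<bar>"])
    show "integrable (S.M x) (\<lambda>l. \<bar>l\<bar>)" using int by simp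
    show "AE l in S.M x. (\<lambda>n. indicator {- real n<..real n} l *\<^sub>R l) \<longlonglongrightarrow> l"
    proof (rule AE_I2)
      fix l :: real
      obtain N where N: "\<bar>l\<bar> < real N" using reals_Archimedean2 by blast
      have "\<forall>\<^sub>F n in sequentially. indicator {- real n<..real n} l *\<^sub>R l = l"
        using eventually_ge_at_top[of N]
      proof eventually_elim
        case (elim n)
        then have "l \<in> {- real n<..real n}" using N by auto
        then show ?case by simp
      qed
      then show "(\<lambda>n. indicator {- real n<..real n} l *\<^sub>R l) \<longlonglongrightarrow> l" by (rule tendsto_eventually)
    qed
    show "AE l in S.M x. norm (indicator {- real n<..real n} l *\<^sub>R l) \<le> \<bar>l\<bar>" for n
      by (simp add: indicator_def)
  qed simp_all
  moreover have "(LINT l:{- real n<..real n}|S.M x. l) = \<langle>trunc n (A x), trunc n x\<rangle>" for n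
    using spectral_integrals_Ioc(1)[of "- real n" "real n" x] trunc_A[OF x, of n] by (simp add: trunc_def)
  moreover have "(\<lambda>n. \<langle>trunc n (A x), trunc n x\<rangle>) \<longlonglongrightarrow> \<langle>A x, x\<rangle>"
    by (intro tendsto trunc_tendsto)
  ultimately show "(\<integral>l. l \<partial>S.M x) = \<langle>A x, x\<rangle>" using LIMSEQ_unique by simp
qed

text \<open>
  Uniqueness: if the first and second moments of the spectral measures of a spectral family \<open>G\<close>
  describe \<open>A\<close>, then \<open>G l\<close> cuts \<open>A\<close> at \<open>l\<close>, which characterizes \<open>E l\<close>.
\<close>

lemma spectral_family_unique:
  assumes G: "real_spectral_family ip G"
    and dom: "D = {x. (\<integral>\<^sup>+l. ennreal (l\<^sup>2) \<partial>real_spectral_family.M ip G x) < \<infinity>}"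
    and int: "\<And>x. x \<in> D \<Longrightarrow> integrable (real_spectral_family.M ip G x) (\<lambda>l. l)"
    and form: "\<And>x. x \<in> D \<Longrightarrow> \<langle>A x, x\<rangle> = (\<integral>l. l \<partial>real_spectral_family.M ip G x)"
  shows "G = E"
proof
  fix l
  interpret G: real_spectral_family ip G by fact
  note Gl = G.proj[of l]
  \<comment> \<open>By \<open>M_below\<close> the measure of \<open>G l x\<close> is a restriction
    of that of \<open>x\<close>, so its second moment stays finite.\<close>
  have GD: "G l x \<in> D" if "x \<in> D" for x
  proof -
    have "(\<integral>\<^sup>+t. ennreal (t\<^sup>2) \<partial>G.M (G l x)) = (\<integral>\<^sup>+t. indicator {..l} t * ennreal (t\<^sup>2) \<partial>G.M x)"
      by (simp add: G.M_below nn_integral_density)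
    also have "\<dots> \<le> (\<integral>\<^sup>+t. ennreal (t\<^sup>2) \<partial>G.M x)"
      by (intro nn_integral_mono) (simp add: indicator_def)
    also have "\<dots> < \<infinity>" using that dom by simp
    finally show ?thesis using dom by simp
  qed
  have integrable_indicator: "integrable (G.M x) (\<lambda>t. indicator S t * f t)"
    if "integrable (G.M x) f" "S \<in> sets borel" for f :: "real \<Rightarrow> real" and S x
    using integrable_mult_indicator[of S "G.M x" f] that by simp
  have density: "(\<integral>t. t \<partial>G.M y) = (\<integral>t. indicator S t * t \<partial>G.M x)"
    if "G.M y = density (G.M x) (indicator S)" "S \<in> sets borel" for x y S
  proof -
    have "G.M y = density (G.M x) (\<lambda>t. ennreal (indicator S t))"
      using that(1) by (simp add: ennreal_indicator)
    then show ?thesis using that(2) by (simp add: integral_density)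
  qed
  have split: "\<langle>A x, x\<rangle> = \<langle>A (G l x), G l x\<rangle> + \<langle>A (x - G l x), x - G l x\<rangle>" if x: "x \<in> D" for x
  proof -
    have "(\<integral>t. t \<partial>G.M x) = (\<integral>t. indicator {..l} t * t + indicator {l<..} t * t \<partial>G.M x)"
      by (intro Bochner_Integration.integral_cong) (auto simp: indicator_def)
    also have "\<dots> = (\<integral>t. indicator {..l} t * t \<partial>G.M x) + (\<integral>t. indicator {l<..} t * t \<partial>G.M x)"
      using int[OF x]
      by (intro Bochner_Integration.integral_add integrable_indicator) simp_all
    finally show ?thesis
      using x GD[OF x] density[OF G.M_below] density[OF G.M_above] by (simp add: form D_diff)
  qed
  \<comment> \<open>Applied to \<open>u + v\<close>, \<open>split\<close> makes the two mixed terms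
    cancel; by symmetry over the reals they are equal, so both vanish.\<close>
  have orth: "\<langle>A u, v\<rangle> = 0" if "u \<in> D" "G l u = u" "v \<in> D" "G l v = 0" for u v
  proof -
    have "\<langle>A (u + v), u + v\<rangle> = \<langle>A u, u\<rangle> + \<langle>A v, v\<rangle>"
      using split[of "u + v"] that by (simp add: D_add proj_add[OF Gl])
    then have "\<langle>A u, v\<rangle> + \<langle>A v, u\<rangle> = 0" using that by (simp add: A_add bilin)
    then show ?thesis using A_sym[OF that(3,1)] commute[of v "A u"] by simp
  qed
  \<comment> \<open>\<open>orth\<close> is available only for vectors of \<open>D\<close>; density
    of \<open>D\<close> upgrades it to \<open>A u = G l (A u)\<close> and
    \<open>G l (A v) = 0\<close>.\<close>
  have "reduces (G l)"
    unfolding reduces_def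
  proof safe
    fix x assume x: "x \<in> D"
    define u v where "u = G l x" and "v = x - G l x"
    have u: "u \<in> D" "G l u = u" and v: "v \<in> D" "G l v = 0"
      using x GD by (simp_all add: u_def v_def D_diff proj_diff[OF Gl] proj_idem[OF Gl])
    show "G l x \<in> D" using u(1) by (simp add: u_def)
    have "\<langle>A u - G l (A u), y\<rangle> = 0" if y: "y \<in> D" for y
    proof -
      have "\<langle>A u, y - G l y\<rangle> = 0"
        using orth[OF u, of "y - G l y"] y GD by (simp add: D_diff proj_diff[OF Gl] proj_idem[OF Gl])
      then show ?thesis by (simp add: bilin proj_sym[OF Gl])
    qed
    then have Au: "A u = G l (A u)" using dense_orth[of "A u - G l (A u)"] by simp
    have "\<langle>G l (A v), y\<rangle> = 0" if y: "y \<in> D" for y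
    proof -
      have "\<langle>A (G l y), v\<rangle> = 0"
        using orth[OF _ _ v, of "G l y"] y GD by (simp add: proj_idem[OF Gl])
      then show ?thesis using A_sym[OF GD[OF y] v(1)] commute[of "G l y" "A v"] by (simp add: proj_sym[OF Gl])
    qed
    then have Av: "G l (A v) = 0" using dense_orth[of "G l (A v)"] by simp
    have "A x = A u + A v" using A_add[OF u(1) v(1)] by (simp add: u_def v_def)
    then show "A (G l x) = G l (A x)" using Au Av by (simp add: u_def proj_add[OF Gl])
  qed
  moreover have "\<langle>A u, u\<rangle> \<le> l * (norm u)\<^sup>2" if u: "u \<in> D" "G l u = u" for u
  proof -
    interpret finite_measure "G.M u" by (rule G.M_finite)
    have "\<langle>A u, u\<rangle> = (\<integral>t. indicator {..l} t * t \<partial>G.M u)"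
      using form[OF u(1)] density[of u u "{..l}"] G.M_below[of l u] u(2) by simp
    also have "\<dots> \<le> (\<integral>t. indicator {..l} t * l \<partial>G.M u)"
      using int[OF u(1)]
      by (intro integral_mono integrable_indicator) (auto simp: indicator_def)
    also have "\<dots> = l * measure (G.M u) {..l}" by simp
    also have "measure (G.M u) {..l} = (norm u)\<^sup>2"
      using G.M_cdf[of u l] u(2) by (simp add: cdf_def self)
    finally show ?thesis .
  qed
  moreover have "l * (norm v)\<^sup>2 < \<langle>A v, v\<rangle>" if v: "v \<in> D" "G l v = 0" "v \<noteq> 0" for v
  proof -
    interpret finite_measure "G.M v" by (rule G.M_finite)
    have M: "G.M v = density (G.M v) (indicator {l<..})" using G.M_above[of v l] v(2) by simp
    have tot: "measure (G.M v) {l<..} = (norm v)\<^sup>2"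
    proof -
      have "emeasure (G.M v) {l<..} = emeasure (G.M v) UNIV"
        by (subst (2) M) (simp add: emeasure_restricted)
      then show ?thesis by (simp add: G.M_UNIV measure_def)
    qed
    \<comment> \<open>\<open>g\<close> is \<open>t - l\<close> on the open half-line and 0
      elsewhere; its integral is the gap in the inequality. If it vanished, the half-line would be
      null although it carries the whole mass \<open>(norm v)\<^sup>2\<close>.\<close>
    define g where "g t = indicator {l<..} t * t - indicator {l<..} t * l" for t :: real
    have i: "integrable (G.M v) (\<lambda>t. indicator {l<..} t * t)" "integrable (G.M v) (\<lambda>t. indicator {l<..} t * l)"
      using int[OF v(1)] by (intro integrable_indicator; simp)+
    have gi: "integrable (G.M v) g"
      unfolding g_def by (rule Bochner_Integration.integrable_diff[OF i])
    have "\<langle>A v, v\<rangle> = (\<integral>t. indicator {l<..} t * t \<partial>G.M v)"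
      using form[OF v(1)] density[OF M] by simp
    also have "\<dots> = (\<integral>t. g t \<partial>G.M v) + (\<integral>t. indicator {l<..} t * l \<partial>G.M v)"
      unfolding g_def Bochner_Integration.integral_diff[OF i] by simp
    also have "(\<integral>t. indicator {l<..} t * l \<partial>G.M v) = l * (norm v)\<^sup>2" using tot by simp
    finally have e: "\<langle>A v, v\<rangle> = (\<integral>t. g t \<partial>G.M v) + l * (norm v)\<^sup>2" .
    have g0: "0 \<le> g t" for t by (simp add: g_def indicator_def)
    have "(\<integral>t. g t \<partial>G.M v) \<noteq> 0"
    proof
      assume "(\<integral>t. g t \<partial>G.M v) = 0"
      then have "AE t in G.M v. g t = 0"
        using integral_nonneg_eq_0_iff_AE[OF gi] g0 by simp
      then have "AE t in G.M v. t \<notin> {l<..}"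
        by eventually_elim (auto simp: g_def indicator_def)
      then have "measure (G.M v) {l<..} = 0"
        by (subst (asm) AE_iff_measurable[OF _ refl]) (simp_all add: measure_def greaterThan_def)
      then show False using tot v(3) by simp
    qed
    moreover have "0 \<le> (\<integral>t. g t \<partial>G.M v)" using g0 by simp
    ultimately show ?thesis using e by linarith
  qed
  ultimately have "splits l (G l)" unfolding splits_def using Gl by blast
  then show "G l = E l" by (rule splits_unique)
qed

end

section \<open>Reduction of the scalar field to the reals\<close>

lemma kRe_add: "kRe (a + b) = kRe a + kRe (b :: 'k::real_or_complex)"
proof -
  have "of_real (2 * kRe (a + b)) = (a + kcnj a) + (b + kcnj b)"
    unfolding add_kcnj[of "a + b", symmetric] kcnj_add by (simp only: ac_simps)
  also have "\<dots> = of_real (2 * (kRe a + kRe b))"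
    unfolding add_kcnj by (simp add: algebra_simps)
  finally have "of_real (2 * kRe (a + b)) = (of_real (2 * (kRe a + kRe b)) :: 'k)" .
  then show ?thesis unfolding of_real_eq_iff by simp
qed

lemma kRe_of_real [simp]: "kRe (of_real r :: 'k::real_or_complex) = r"
proof -
  have "of_real (2 * kRe (of_real r :: 'k)) = (of_real (2 * r) :: 'k)"
    using add_kcnj[of "of_real r :: 'k"] by (simp add: kcnj_of_real)
  then show ?thesis unfolding of_real_eq_iff by simp
qed

lemma kRe_0 [simp]: "kRe (0 :: 'k::real_or_complex) = 0"
  using kRe_of_real[of 0, where 'k = 'k] by simp

lemma kRe_of_real_mult: "kRe (of_real r * a) = r * kRe (a :: 'k::real_or_complex)"
proof -
  have "of_real (2 * kRe (of_real r * a)) = (of_real (2 * (r * kRe a)) :: 'k)"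
    using add_kcnj[of "of_real r * a"] arg_cong[OF add_kcnj[of a], of "\<lambda>z. of_real r * z"]
    by (simp add: kcnj_mult kcnj_of_real algebra_simps)
  then show ?thesis unfolding of_real_eq_iff by simp
qed

lemma kcnj_kcnj [simp]: "kcnj (kcnj a) = (a :: 'k::real_or_complex)"
proof -
  have "kcnj (a + kcnj a) = a + kcnj a" by (simp only: add_kcnj kcnj_of_real)
  then have "kcnj a + kcnj (kcnj a) = kcnj a + a" unfolding kcnj_add by (simp only: add.commute)
  then show ?thesis by simp
qed

lemma kRe_kcnj [simp]: "kRe (kcnj a) = kRe (a :: 'k::real_or_complex)"
proof -
  have "of_real (2 * kRe (kcnj a)) = (of_real (2 * kRe a) :: 'k)"
    unfolding add_kcnj[symmetric] by (simp add: add.commute)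
  then show ?thesis unfolding of_real_eq_iff by simp
qed

text \<open>The choice \<open>c = kcnj a\<close> produces the squared modulus. Scalar-valued
  identities are recovered from real parts in this way.\<close>

lemma eq_0_if_kRe_mult:
  fixes a :: "'k::real_or_complex"
  assumes "\<And>c. kRe (c * a) = 0"
  shows "a = 0"
proof -
  have "kRe (a * kcnj a) = 0" using assms[of "kcnj a"] by (simp only: mult.commute)
  then have "(norm a)\<^sup>2 = 0" unfolding mult_kcnj kRe_of_real .
  then show ?thesis by simp
qed

lemma eq_of_real_if_kcnj_eq: "kcnj a = a \<Longrightarrow> a = of_real (kRe (a :: 'k::real_or_complex))"
proof -
  assume "kcnj a = a"
  then have "a + a = of_real (2 * kRe a)" using add_kcnj[of a] by metis
  then have "2 * a = 2 * of_real (kRe a)" by (simp only: mult_2 of_real_add)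
  then show ?thesis by (rule mult_left_cancel[THEN iffD1, rotated]) simp
qed

context hilbert_space
begin

abbreviation rip :: "'h \<Rightarrow> 'h \<Rightarrow> real" where "rip x y \<equiv> kRe (ip x y)"

lemma ip_scale_right: "ip x (smul a y) = kcnj a * ip x y"
  using ip_commute[of x "smul a y"] ip_commute[of x y] by (simp add: ip_scale_left kcnj_mult)

sublocale R: real_hilbert rip
proof
  show "kRe (ip (r *\<^sub>R x) z) = r * kRe (ip x z)" for r x z
    by (simp add: scale_of_real[symmetric] ip_scale_left kRe_of_real_mult)
  show "kRe (ip x y) = kRe (ip y x)" for x y by (subst ip_commute) simp
  show "kRe (ip x x) = (norm x)\<^sup>2" for x unfolding ip_self by (rule kRe_of_real)
qed (simp add: ip_add_left kRe_add)

lemma rip_scale: "rip (smul a x) y = rip x (smul (kcnj a) y)"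
  by (simp add: ip_scale_left ip_scale_right)

lemma unimodular: "norm a = 1 \<Longrightarrow> kcnj a = inverse a" "norm a = 1 \<Longrightarrow> a \<noteq> 0"
proof -
  assume "norm a = 1"
  then have "a * kcnj a = 1" "a \<noteq> 0" using mult_kcnj[of a] by auto
  then show "kcnj a = inverse a" "a \<noteq> 0" by (simp_all add: inverse_unique)
qed

lemma norm_unimodular: "norm a = 1 \<Longrightarrow> norm (smul a x) = norm x"
proof -
  assume a: "norm a = 1"
  have "(norm (smul a x))\<^sup>2 = (norm x)\<^sup>2"
    unfolding R.self[symmetric] rip_scale by (simp add: unimodular[OF a])
  then show ?thesis by simp
qed

lemma subspace_real: "subspace V \<Longrightarrow> Real_Vector_Spaces.subspace V"
  unfolding Real_Vector_Spaces.subspace_def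
  by (auto simp: subspace_0 subspace_add subspace_scale scale_of_real[symmetric])

text \<open>Nonnegative real factors belong to the real structure, so compatibility with scalars
  needs proof only for unimodular ones, which act as isometries.\<close>

lemma scale_polar: "\<exists>u. norm u = 1 \<and> (\<forall>x. smul a x = norm a *\<^sub>R smul u x)"
proof (cases "a = 0")
  case True
  then show ?thesis by (intro exI[of _ 1]) simp
next
  case False
  define u where "u = of_real (inverse (norm a)) * a"
  have "norm u = 1" using False by (simp add: u_def norm_mult norm_inverse)
  moreover have "of_real (norm a) * u = a" using False by (simp add: u_def)
  then have "smul a x = norm a *\<^sub>R smul u x" for x by (simp flip: scale_of_real)
  ultimately show ?thesis by blast
qed

lemma orthogonal_projection_real: "orthogonal_projection smul ip P \<Longrightarrow> R.projection P"
proof -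
  assume "orthogonal_projection smul ip P"
  then obtain V where V: "subspace V" "\<And>x. P x \<in> V" "\<And>x y. y \<in> V \<Longrightarrow> ip (x - P x) y = 0"
    unfolding orthogonal_projection_def by blast
  show ?thesis by (rule R.projectionI_range[OF subspace_real[OF V(1)] V(2)]) (simp_all add: V(3))
qed

text \<open>If \<open>P\<close> commutes with scalars, then \<open>smul c x - P (smul c x)\<close>
  is real-orthogonal to \<open>y\<close> for every \<open>c\<close>, which is orthogonality for
  \<open>ip\<close>.\<close>

lemma real_projection_orthogonal:
  assumes P: "R.projection P" and lin: "\<And>a x. P (smul a x) = smul a (P x)"
  shows "orthogonal_projection smul ip P"
  unfolding orthogonal_projection_def
proof (intro exI[of _ "{x. P x = x}"] conjI allI ballI)
  show "subspace {x. P x = x}"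
    by (rule subspaceI) (simp_all add: lin R.proj_0[OF P] R.proj_add[OF P])
  show "closed {x. P x = x}"
    by (intro closed_Collect_eq bounded_linear.continuous_on[OF R.proj_bounded_linear[OF P]] continuous_intros)
  show "P x \<in> {x. P x = x}" for x by (simp add: R.proj_idem[OF P])
  show "ip (x - P x) y = 0" if y: "y \<in> {x. P x = x}" for x y
  proof (rule eq_0_if_kRe_mult)
    fix c
    have "kRe (c * ip (x - P x) y) = rip (smul c x - P (smul c x)) y"
      by (simp add: ip_scale_left[symmetric] scale_right_diff_distrib lin)
    also have "\<dots> = 0" using R.proj_orth[OF P, of y "smul c x"] y by simp
    finally show "kRe (c * ip (x - P x) y) = 0" .
  qed
qed

lemma spectral_family_real:
  assumes "spectral_family smul ip G"
  shows "real_spectral_family rip G"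
proof -
  have proj: "R.projection (G l)" for l
    using assms orthogonal_projection_real unfolding spectral_family_def by blast
  have le: "rip (G l x) x \<le> rip (G m x) x" if "l \<le> m" for l m x
    using assms that unfolding spectral_family_def op_le_def by blast
  show ?thesis
  proof
    show "G m (G l x) = G l x" "G l (G m x) = G l x" if "l \<le> m" for l m x
      using R.projection_le[OF proj proj le[OF that]] by blast+
    show "((\<lambda>m. G m x) \<longlongrightarrow> G l x) (at_right l)" for x l
      using assms unfolding spectral_family_def continuous_within by blast
  qed (use assms proj in \<open>simp_all add: spectral_family_def\<close>)
qed

text \<open>Density of \<open>D\<close> makes the vector described in \<open>adjoint_op\<close>
  unique, so the description really denotes it.\<close>

lemma self_adjoint_symmetric:
  assumes sa: "self_adjoint smul ip D A" and x: "x \<in> D" and y: "y \<in> D"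
  shows "ip (A x) y = ip x (A y)"
proof -
  have dense: "closure D = UNIV" using sa unfolding self_adjoint_def by blast
  obtain z where z: "\<forall>x\<in>D. ip (A x) y = ip x z"
    using sa y unfolding self_adjoint_def adjoint_domain_def by blast
  have "w = z" if w: "\<forall>x\<in>D. ip (A x) y = ip x w" for w
  proof -
    have "rip (w - z) x = 0" if "x \<in> D" for x
    proof -
      have "rip x w = rip x z" using w z that by simp
      then show ?thesis unfolding R.commute[of "w - z" x] R.diff_right by simp
    qed
    then have "rip (w - z) (w - z) = 0" using R.orth_closure[of "w - z" D] dense by simp
    then show ?thesis by (simp add: R.self)
  qed
  then have "adjoint_op ip D A y = z" unfolding adjoint_op_def using z by (intro the_equality) blast+
  then have "A y = z" using sa y unfolding self_adjoint_def by simp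
  then show ?thesis using z x by simp
qed

text \<open>Taking real parts could enlarge the adjoint domain; since \<open>D\<close> is stable
  under all scalars, replacing \<open>x\<close> by its multiples restores the scalar-valued
  identity.\<close>

lemma self_adjoint_real:
  assumes sa: "self_adjoint smul ip D A"
  shows "real_self_adjoint rip D A"
proof
  have lin: "linear_operator smul D A" and dom: "adjoint_domain ip D A = D"
    using sa unfolding self_adjoint_def by blast+
  have D: "subspace D" and A_scale: "\<And>a x. x \<in> D \<Longrightarrow> A (smul a x) = smul a (A x)"
    using lin unfolding linear_operator_def by blast+
  show "Real_Vector_Spaces.subspace D" using subspace_real[OF D] .
  show "closure D = UNIV" using sa unfolding self_adjoint_def by blast
  show "A (x + y) = A x + A y" if "x \<in> D" "y \<in> D" for x y
    using lin that unfolding linear_operator_def by blast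
  show "A (r *\<^sub>R x) = r *\<^sub>R A x" if "x \<in> D" for r x
    using A_scale[OF that, of "of_real r"] by (simp only: scale_of_real)
  show "rip (A x) y = rip x (A y)" if "x \<in> D" "y \<in> D" for x y
    by (simp add: self_adjoint_symmetric[OF sa that])
  show "y \<in> D" if *: "\<And>x. x \<in> D \<Longrightarrow> rip (A x) y = rip x z" for y z
  proof -
    have "ip (A x) y - ip x z = 0" if x: "x \<in> D" for x
    proof (rule eq_0_if_kRe_mult)
      fix c
      have "rip (A (smul c x)) y = rip (smul c x) z" using * D x by (simp add: subspace_scale)
      moreover have "c * ip (A x) y = c * (ip (A x) y - ip x z) + c * ip x z" by (simp add: algebra_simps)
      ultimately show "kRe (c * (ip (A x) y - ip x z)) = 0"
        by (simp add: A_scale[OF x] ip_scale_left kRe_add)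
    qed
    then have "y \<in> adjoint_domain ip D A" unfolding adjoint_domain_def by auto
    then show ?thesis using dom by simp
  qed
qed

text \<open>
  Conjugation by a unimodular scalar preserves the properties that determine \<open>E l\<close>; hence
  \<open>E l\<close>, constructed over the reals, commutes with all scalars.
\<close>

lemma E_scale:
  assumes sa: "self_adjoint smul ip D A"
  shows "real_self_adjoint.E rip D A l (smul a x) = smul a (real_self_adjoint.E rip D A l x)"
proof -
  interpret T: real_self_adjoint rip D A by (rule self_adjoint_real[OF sa])
  have D: "subspace D" and A_scale: "\<And>a x. x \<in> D \<Longrightarrow> A (smul a x) = smul a (A x)"
    using sa unfolding self_adjoint_def linear_operator_def by blast+
  note DS = subspace_scale[OF D]
  have unimod: "T.E l (smul u x) = smul u (T.E l x)" if u: "norm u = 1" for u x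
  proof -
    note u' = unimodular[OF u]
    have iso: "rip (smul u x) (smul u y) = rip x y" for x y
      unfolding rip_scale by (simp add: u')
    have move: "rip (smul (inverse u) x) y = rip x (smul u y)" for x y
      using iso[of "smul (inverse u) x" y] u'(2) by simp
    define Q where "Q = (\<lambda>x. smul (inverse u) (T.E l (smul u x)))"
    have fixed: "Q x = y \<longleftrightarrow> T.E l (smul u x) = smul u y" for x y
      using u'(2) by (auto simp: Q_def)
    have "R.sym Q"
      unfolding R.sym_def
    proof (intro allI)
      fix x y
      have "rip (Q x) y = rip (smul u x) (T.E l (smul u y))"
        by (simp only: Q_def move R.proj_sym[OF T.E_projection])
      also have "\<dots> = rip x (Q y)"
        using move[of "T.E l (smul u y)" x] R.commute[of x "Q y"]
          R.commute[of "smul u x" "T.E l (smul u y)"] by (simp add: Q_def)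
      finally show "rip (Q x) y = rip x (Q y)" .
    qed
    moreover have "Q (Q x) = Q x" for x
      using u'(2) by (simp add: Q_def R.proj_idem[OF T.E_projection])
    ultimately have "R.projection Q" unfolding R.projection_def by blast
    moreover have "T.reduces Q"
      unfolding T.reduces_def Q_def
      by (simp add: DS A_scale T.reducesD[OF T.E_reduces])
    moreover have "rip (A x) x \<le> l * (norm x)\<^sup>2" if x: "x \<in> D" "Q x = x" for x
      using T.E_upper[OF DS[OF x(1), of u], of l] x(2)
      by (simp add: fixed A_scale[OF x(1)] iso norm_unimodular[OF u])
    moreover have "l * (norm x)\<^sup>2 < rip (A x) x" if x: "x \<in> D" "Q x = 0" "x \<noteq> 0" for x
      using T.E_lower[OF DS[OF x(1), of u], of l] x(2,3) u'(2)
      by (simp add: fixed A_scale[OF x(1)] iso norm_unimodular[OF u])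
    ultimately have "T.splits l Q" unfolding T.splits_def by blast
    then have "Q = T.E l" by (rule T.splits_unique)
    then show ?thesis using fixed[of x "T.E l x"] by simp
  qed
  obtain u where u: "norm u = 1" "\<And>x. smul a x = norm a *\<^sub>R smul u x"
    using scale_polar[of a] by blast
  show ?thesis by (simp add: u(2) R.proj_scale[OF T.E_projection] unimod[OF u(1)])
qed

end

theorem theorem1:
  fixes smul :: "'k::real_or_complex \<Rightarrow> 'h::banach \<Rightarrow> 'h"
    and ip :: "'h \<Rightarrow> 'h \<Rightarrow> 'k"
    and D :: "'h set"
    and A :: "'h \<Rightarrow> 'h"
  assumes "hilbert_space smul ip"
    and "self_adjoint smul ip D A"
  shows "\<exists>!E :: real \<Rightarrow> 'h \<Rightarrow> 'h.
           spectral_family smul ip E \<and> is_spectral_integral ip D A E"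
proof -
  interpret hilbert_space smul ip by (rule assms(1))
  interpret T: real_self_adjoint rip D A by (rule self_adjoint_real[OF assms(2)])
  have M: "spectral_measure ip G x = real_spectral_family.M rip G x"
    if "real_spectral_family rip G" for G x
    unfolding spectral_measure_def real_spectral_family.M_def[OF that] ..
  note ME = M[OF T.S.real_spectral_family_axioms]
  show ?thesis
  proof (intro ex1I[of _ T.E] conjI)
    show "spectral_family smul ip T.E"
      unfolding spectral_family_def op_le_def continuous_within
      using real_projection_orthogonal[OF T.E_projection E_scale[OF assms(2)]]
        T.S.distribution_mono T.E_right_continuous T.E_at_bot T.E_at_top
      by blast
    \<comment> \<open>\<open>is_spectral_integral\<close> asks for an equality of scalars; the form
      of \<open>A\<close> is fixed by conjugation because \<open>A\<close> is symmetric, hence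
      real.\<close>
    have "ip (A x) x = of_real (rip (A x) x)" if "x \<in> D" for x
      using self_adjoint_symmetric[OF assms(2) that that] ip_commute[of x "A x"]
      by (intro eq_of_real_if_kcnj_eq) simp
    then show "is_spectral_integral ip D A T.E"
      unfolding is_spectral_integral_def ME
      using T.domain_eq T.integral_eq T.square_integral_eq by simp
  next
    fix G assume G: "spectral_family smul ip G \<and> is_spectral_integral ip D A G"
    then have fam: "real_spectral_family rip G" using spectral_family_real by blast
    show "G = T.E"
    proof (rule T.spectral_family_unique[OF fam])
      show "D = {x. (\<integral>\<^sup>+l. ennreal (l\<^sup>2) \<partial>real_spectral_family.M rip G x) < \<infinity>}"
        using G unfolding is_spectral_integral_def M[OF fam] by blast
      show "integrable (real_spectral_family.M rip G x) (\<lambda>l. l)" if "x \<in> D" for x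
        using G that unfolding is_spectral_integral_def M[OF fam] by blast
      show "rip (A x) x = (\<integral>l. l \<partial>real_spectral_family.M rip G x)" if "x \<in> D" for x
        using G that unfolding is_spectral_integral_def M[OF fam] by simp
    qed
  qed
qed

end
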